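(* Suppose that $d\leq 2$. For $P\in\mathfrak{P}_+$ let $f^p:\mathfrak{P}_+\to\mathfrak{C}_+$ be the map sending $Q$ to $c=(c_{\mathbf{k}})_{\mathbf{k}\in\Lambda}$ with $$c_{\mathbf{k}} = \int_{\mathbb{T}^d} e^{i (\mathbf{k}, \boldsymbol{\theta})} \frac{P}{Q}\, dm, \quad \mathbf{k}\in\Lambda,$$ and let $c \in \mathfrak{C}_+$ be fixed. Then the function $g^c: \mathfrak{P}_+ \rightarrow \mathfrak{P}_+$ mapping $P$ to $Q = (f^p)^{-1}(c)$ is a diffeomorphism onto its image $\mathfrak{Q}_+$.
   Context: Let $d\ge 1$, $\mathbb{T}=(-\pi,\pi]$, $\boldsymbol{\theta}=(\theta_1,\dots,\theta_d)$, $e^{i\boldsymbol{\theta}}=(e^{i\theta_1},\dots,e^{i\theta_d})$, $(\mathbf{k},\boldsymbol{\theta})=\sum_{j=1}^d k_j\theta_j$, and $dm(\boldsymbol{\theta})=(1/2\pi)^d\prod_{j=1}^d d\theta_j$. The index set $\Lambda\subset\mathbb{Z}^d$ is finite with $0\in\Lambda$ and $-\Lambda=\Lambda$. Trigonometric polynomials are $P(e^{i\boldsymbol{\theta}})=\sum_{\mathbf{k}\in\Lambda}p_{\mathbf{k}}e^{-i(\mathbf{k},\boldsymbol{\theta})}$ with $p_{-\mathbf{k}}=\bar p_{\mathbf{k}}$ (real valued), identified with their coefficient vector $p=(p_{\mathbf{k}})_{\mathbf{k}\in\Lambda}$ (similarly $Q\leftrightarrow q$). $\mathfrak{P}_+$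 is the convex cone of such polynomials that are positive for all $\boldsymbol{\theta}\in\mathbb{T}^d$; $\bar{\mathfrak{P}}_+$ is its closure. Sequences $c=(c_{\mathbf{k}})_{\mathbf{k}\in\Lambda}$ are complex with $c_{-\mathbf{k}}=\bar c_{\mathbf{k}}$; $\langle c,p\rangle=\sum_{\mathbf{k}\in\Lambda}c_{\mathbf{k}}\bar p_{\mathbf{k}}$. $\mathfrak{C}_+=\{c\mid\langle c,p\rangle>0\text{ for all }P\in\bar{\mathfrak{P}}_+\setminus\{0\}\}$. Both $\mathfrak{P}_+$ and $\mathfrak{C}_+$ are regarded as open subsets of the real vector space $\{(r_{\mathbf{k}})_{\mathbf{k}\in\Lambda}\in\mathbb{C}^{|\Lambda|}\mid r_{-\mathbf{k}}=\bar r_{\mathbf{k}}\}\cong\mathbb{R}^{|\Lambda|}$. For $d\le2$ the map $f^p$ is a bijection (indeed a diffeomorphism) for each $P\in\mathfrak{P}_+$, so $g^c$ is well defined. *)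

theory Defs
  imports "HOL-Analysis.Analysis"
begin

text \<open>
  The finite index set \<open>\<Lambda> \<subseteq> \<int>\<^sup>d\<close> is enumerated by a bijection \<open>ix\<close> from a finite type \<open>'l\<close> onto
  \<open>\<Lambda>\<close>, so that families \<open>(r\<^sub>k)\<close> indexed by \<open>k \<in> \<Lambda>\<close> are vectors \<open>r :: complex ^ 'l\<close>, the component
  \<open>r $ l\<close> being \<open>r\<^sub>k\<close> for \<open>k = ix l\<close>. The dimension \<open>d\<close> is \<open>CARD('d)\<close>.
\<close>

definition herm_space :: "('l::finite \<Rightarrow> int ^ 'd::finite) \<Rightarrow> (complex ^ 'l) set" where
  "herm_space ix = {r. \<forall>l m. ix m = - ix l \<longrightarrow> r $ m = cnj (r $ l)}"

definition torus :: "(real ^ 'd::finite) set" where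
  "torus = {\<theta>. \<forall>j. - pi < \<theta> $ j \<and> \<theta> $ j \<le> pi}"

definition pairing :: "int ^ 'd::finite \<Rightarrow> real ^ 'd \<Rightarrow> real" where
  "pairing k \<theta> = (\<Sum>j\<in>UNIV. of_int (k $ j) * \<theta> $ j)"

definition torus_integral :: "(real ^ 'd::finite \<Rightarrow> complex) \<Rightarrow> complex" where
  "torus_integral F = (1 / (2 * pi)) ^ CARD('d) *\<^sub>R (LINT \<theta>:torus|lborel. F \<theta>)"

definition trig_poly ::
  "('l::finite \<Rightarrow> int ^ 'd::finite) \<Rightarrow> complex ^ 'l \<Rightarrow> real ^ 'd \<Rightarrow> complex" where
  "trig_poly ix p \<theta> = (\<Sum>l\<in>UNIV. p $ l * exp (- \<i> * of_real (pairing (ix l) \<theta>)))"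

text \<open>
  For coefficients in \<^const>\<open>herm_space\<close>, both \<^const>\<open>trig_poly\<close> and the pairing \<open>coeff_inner\<close>
  below are real valued (the index set being symmetric), so positivity is positivity of the
  real part.
\<close>

definition P_plus :: "('l::finite \<Rightarrow> int ^ 'd::finite) \<Rightarrow> (complex ^ 'l) set" where
  "P_plus ix = {p \<in> herm_space ix. \<forall>\<theta>\<in>torus. 0 < Re (trig_poly ix p \<theta>)}"

definition coeff_inner :: "complex ^ 'l::finite \<Rightarrow> complex ^ 'l \<Rightarrow> complex" where
  "coeff_inner c p = (\<Sum>l\<in>UNIV. c $ l * cnj (p $ l))"

definition C_plus :: "('l::finite \<Rightarrow> int ^ 'd::finite) \<Rightarrow> (complex ^ 'l) set" where
  "C_plus ix =
    {c \<in> herm_space ix. \<forall>p \<in> closure (P_plus ix) - {0}. 0 < Re (coeff_inner c p)}"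

definition moment_map ::
  "('l::finite \<Rightarrow> int ^ 'd::finite) \<Rightarrow> complex ^ 'l \<Rightarrow> complex ^ 'l \<Rightarrow> complex ^ 'l" where
  "moment_map ix p q =
    (\<chi> l. torus_integral (\<lambda>\<theta>. exp (\<i> * of_real (pairing (ix l) \<theta>)) *
                                (trig_poly ix p \<theta> / trig_poly ix q \<theta>)))"

definition g_map ::
  "('l::finite \<Rightarrow> int ^ 'd::finite) \<Rightarrow> complex ^ 'l \<Rightarrow> complex ^ 'l \<Rightarrow> complex ^ 'l" where
  "g_map ix c p = the_inv_into (P_plus ix) (moment_map ix p) c"

definition Q_plus ::
  "('l::finite \<Rightarrow> int ^ 'd::finite) \<Rightarrow> complex ^ 'l \<Rightarrow> (complex ^ 'l) set" where
  "Q_plus ix c = g_map ix c ` P_plus ix"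

text \<open>
  \<open>Ck_on n V U f\<close>: on the relatively open subset \<open>U\<close> of the real subspace \<open>V\<close>, the map \<open>f\<close> is \<open>n\<close>
  times continuously differentiable. Since \<open>U\<close> need not be open in the ambient space, the
  derivative within \<open>U\<close> is determined only on \<open>V\<close>; the witness \<open>f'\<close> extends it to the ambient space,
  and only its values at directions \<open>v \<in> V\<close> are used.
\<close>

primrec Ck_on ::
  "nat \<Rightarrow> 'a::real_normed_vector set \<Rightarrow> 'a set \<Rightarrow> ('a \<Rightarrow> 'b::real_normed_vector) \<Rightarrow> bool" where
  "Ck_on 0 V U f \<longleftrightarrow> continuous_on U f"
| "Ck_on (Suc n) V U f \<longleftrightarrow>
    (\<exists>f'. (\<forall>x\<in>U. (f has_derivative f' x) (at x within U)) \<and>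
          (\<forall>v\<in>V. Ck_on n V U (\<lambda>x. f' x v)))"

definition smooth_on ::
  "'a::real_normed_vector set \<Rightarrow> 'a set \<Rightarrow> ('a \<Rightarrow> 'b::real_normed_vector) \<Rightarrow> bool" where
  "smooth_on V U f \<longleftrightarrow> (\<forall>n. Ck_on n V U f)"

definition diffeomorphism_on ::
  "'a::real_normed_vector set \<Rightarrow> 'a set \<Rightarrow> 'a set \<Rightarrow> ('a \<Rightarrow> 'a) \<Rightarrow> bool" where
  "diffeomorphism_on V U W f \<longleftrightarrow>
    openin (top_of_set V) U \<and> openin (top_of_set V) W \<and> bij_betw f U W \<and>
    smooth_on V U f \<and> smooth_on V W (the_inv_into U f)"

end

theory Submission
  imports Defs
begin

text \<open>
  Write \<open>c = A q p\<close>, where \<open>A q\<close> is the Hermitian matrix with entries \<open>\<integral> exp (i (k - l, \<theta>)) / Q dm\<close>. Matrices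
  of this kind with a positive weight in place of \<open>1 / Q\<close> are positive definite, as the characters are
  linearly independent. On the solution set of \<open>A q p = c\<close> the increments satisfy
  \<open>A q' (p' - p) = S (q' - q)\<close> exactly, where \<open>S\<close> is such a matrix with weight \<open>P / (Q Q')\<close>. Hence
  each of \<open>p\<close> and \<open>q\<close> determines the other, and either one is differentiable in the other with a
  derivative that is a rational expression in moments; iterating gives smoothness.

  Surjectivity of the moment map, and continuity of \<open>q\<close> in \<open>p\<close>, come from properness: \<open>\<langle>c, q\<rangle> = \<integral> P dm\<close>
  bounds \<open>q\<close>, and a limit of solutions cannot acquire a zero because in dimension at most 2
  a nonnegative trigonometric polynomial with a zero has a divergent integral \<open>\<integral> 1 / Q dm\<close>. So the
  image of the moment map is closed in the convex set \<open>C_plus ix\<close>, and it is open by invariance of domain.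
\<close>

section \<open>Characters of the torus\<close>

definition fourier_char :: "int ^ 'd::finite \<Rightarrow> real ^ 'd \<Rightarrow> complex" where
  "fourier_char k \<theta> = exp (\<i> * of_real (pairing k \<theta>))"

text \<open>The compact cube that replaces the half-open \<open>torus\<close>. The two differ by a
  null set, so integrals agree, while compactness yields integrability and extrema.\<close>

abbreviation torus_box :: "(real ^ 'd::finite) set" where
  "torus_box \<equiv> cbox (\<chi> j. - pi) (\<chi> j. pi)"

lemma continuous_on_pairing [continuous_intros]:
  "continuous_on S f \<Longrightarrow> continuous_on S (\<lambda>x. pairing k (f x))"
  unfolding pairing_def by (intro continuous_intros)

lemma continuous_on_fourier_char [continuous_intros]:
  "continuous_on S f \<Longrightarrow> continuous_on S (\<lambda>x. fourier_char k (f x))"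
  unfolding fourier_char_def by (intro continuous_intros)

lemma pairing_zero_left [simp]: "pairing 0 \<theta> = 0"
  by (simp add: pairing_def)

lemma pairing_minus_left [simp]: "pairing (- k) \<theta> = - pairing k \<theta>"
  by (simp add: pairing_def sum_negf)

lemma pairing_diff_left: "pairing (k - l) \<theta> = pairing k \<theta> - pairing l \<theta>"
  by (simp add: pairing_def sum_subtractf algebra_simps)

lemma pairing_add_right: "pairing k (\<theta> + \<phi>) = pairing k \<theta> + pairing k \<phi>"
  by (simp add: pairing_def sum.distrib algebra_simps)

lemma pairing_diff_right: "pairing k (\<theta> - \<phi>) = pairing k \<theta> - pairing k \<phi>"
  by (simp add: pairing_def sum_subtractf algebra_simps)

lemma fourier_char_zero [simp]: "fourier_char 0 \<theta> = 1"
  by (simp add: fourier_char_def)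

lemma norm_fourier_char [simp]: "norm (fourier_char k \<theta>) = 1"
  by (simp add: fourier_char_def)

lemma fourier_char_nonzero [simp]: "fourier_char k \<theta> \<noteq> 0"
  by (simp add: fourier_char_def)

lemma fourier_char_minus: "fourier_char (- k) \<theta> = exp (- \<i> * of_real (pairing k \<theta>))"
  by (simp add: fourier_char_def)

lemma cnj_fourier_char: "cnj (fourier_char k \<theta>) = fourier_char (- k) \<theta>"
  by (simp add: fourier_char_def exp_cnj)

lemma fourier_char_diff: "fourier_char (k - l) \<theta> = fourier_char k \<theta> * fourier_char (- l) \<theta>"
  by (simp add: fourier_char_def pairing_diff_left algebra_simps flip: exp_add)

lemma fourier_char_add_right: "fourier_char k (\<theta> + \<phi>) = fourier_char k \<theta> * fourier_char k \<phi>"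
  by (simp add: fourier_char_def pairing_add_right algebra_simps flip: exp_add)

lemma fourier_char_diff_right: "fourier_char k (\<theta> - \<phi>) = fourier_char k \<theta> * cnj (fourier_char k \<phi>)"
  by (simp add: fourier_char_def pairing_diff_right algebra_simps exp_cnj flip: exp_add)

lemma fourier_char_periodic:
  fixes n :: "int ^ 'd::finite"
  shows "fourier_char k (\<theta> + (\<chi> j. 2 * pi * of_int (n $ j))) = fourier_char k \<theta>"
proof -
  have "pairing k (\<chi> j. 2 * pi * of_int (n $ j)) = 2 * pi * of_int (\<Sum>j\<in>UNIV. k $ j * n $ j)"
    by (simp add: pairing_def sum_distrib_left mult_ac)
  then have "fourier_char k (\<chi> j. 2 * pi * of_int (n $ j)) =
      exp (\<i> * (of_int (\<Sum>j\<in>UNIV. k $ j * n $ j) * (of_real pi * 2)))"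
    unfolding fourier_char_def by (simp add: mult_ac)
  also have "\<dots> = 1"
    by (rule exp_2pi_1_int)
  finally show ?thesis
    by (simp add: fourier_char_add_right)
qed

lemma torus_representative:
  fixes \<theta> :: "real ^ 'd::finite"
  obtains n :: "int ^ 'd" where "\<theta> + (\<chi> j. 2 * pi * of_int (n $ j)) \<in> torus"
proof
  \<comment> \<open>The largest number of periods that can be added without passing pi; this fits an
    interval closed on the right.\<close>
  let ?n = "(\<chi> j. \<lfloor>(pi - \<theta> $ j) / (2 * pi)\<rfloor>) :: int ^ 'd"
  have "- pi < t + 2 * pi * of_int \<lfloor>(pi - t) / (2 * pi)\<rfloor> \<and>
      t + 2 * pi * of_int \<lfloor>(pi - t) / (2 * pi)\<rfloor> \<le> pi" for t :: real
  proof -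
    have "of_int \<lfloor>(pi - t) / (2 * pi)\<rfloor> \<le> (pi - t) / (2 * pi)"
      "(pi - t) / (2 * pi) < of_int \<lfloor>(pi - t) / (2 * pi)\<rfloor> + 1"
      by linarith+
    then have "of_int \<lfloor>(pi - t) / (2 * pi)\<rfloor> * (2 * pi) \<le> pi - t"
      "pi - t < (of_int \<lfloor>(pi - t) / (2 * pi)\<rfloor> + 1) * (2 * pi)"
      by (simp_all only: pos_le_divide_eq pos_divide_less_eq pi_gt_zero mult_pos_pos zero_less_numeral)
    then show ?thesis
      by (simp add: algebra_simps)
  qed
  then show "\<theta> + (\<chi> j. 2 * pi * of_int (?n $ j)) \<in> torus"
    by (simp add: torus_def)
qed

lemma fourier_char_separates:
  assumes "k \<noteq> l"
  obtains \<theta> where "fourier_char k \<theta> \<noteq> fourier_char l \<theta>"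
proof -
  obtain j where j: "k $ j \<noteq> l $ j"
    using assms by (auto simp: vec_eq_iff)
  \<comment> \<open>Chosen on the axis of a differing coordinate so that the quotient of the two
    characters is exp(i pi) = -1.\<close>
  define \<theta> :: "real ^ 'a" where "\<theta> = axis j (pi / of_int (k $ j - l $ j))"
  have "pairing (k - l) \<theta> = (\<Sum>i\<in>UNIV. if i = j then pi else 0)"
    unfolding pairing_def \<theta>_def using j
    by (intro sum.cong) (auto simp: axis_def divide_simps)
  then have "fourier_char (k - l) \<theta> = -1"
    by (simp add: fourier_char_def)
  moreover have "fourier_char l \<theta> * fourier_char (- l) \<theta> = 1"
    by (metis diff_self fourier_char_diff fourier_char_zero)
  ultimately have "fourier_char k \<theta> \<noteq> fourier_char l \<theta>"
    by (metis fourier_char_diff one_neq_neg_one)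
  then show ?thesis
    by (rule that)
qed

text \<open>Dedekind's argument: translating \<open>\<theta>\<close> and subtracting eliminates one character.\<close>

lemma fourier_char_independent:
  assumes "finite S" "\<And>\<theta>. (\<Sum>k\<in>S. r k * fourier_char k \<theta>) = 0" "k \<in> S"
  shows "r k = 0"
  using assms
proof (induction S arbitrary: r k rule: finite_induct)
  case (insert a S)
  have *: "r l = 0" if "l \<in> S" for l
  proof -
    obtain \<phi> where \<phi>: "fourier_char l \<phi> \<noteq> fourier_char a \<phi>"
      using fourier_char_separates[of l a] \<open>a \<notin> S\<close> \<open>l \<in> S\<close> by metis
    have "r l * (fourier_char l \<phi> - fourier_char a \<phi>) = 0"
    proof (rule insert.IH[OF _ \<open>l \<in> S\<close>])
      fix \<theta>
      have "(\<Sum>k\<in>S. r k * (fourier_char k \<phi> - fourier_char a \<phi>) * fourier_char k \<theta>) =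
          (\<Sum>k\<in>insert a S. r k * (fourier_char k \<phi> - fourier_char a \<phi>) * fourier_char k \<theta>)"
        using insert.hyps by simp
      also have "\<dots> = (\<Sum>k\<in>insert a S. r k * fourier_char k (\<theta> + \<phi>)) -
          fourier_char a \<phi> * (\<Sum>k\<in>insert a S. r k * fourier_char k \<theta>)"
        unfolding sum_distrib_left sum_subtractf[symmetric]
        by (intro sum.cong) (simp_all add: fourier_char_add_right algebra_simps)
      also have "\<dots> = 0"
        using insert.prems(1) by simp
      finally show "(\<Sum>k\<in>S. r k * (fourier_char k \<phi> - fourier_char a \<phi>) * fourier_char k \<theta>) = 0" .
    qed
    then show ?thesis
      using \<phi> by simp
  qed
  moreover have "r a = 0"
    \<comment> \<open>Only the term of \<open>a\<close> is left, and at \<theta> = 0 its character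
      equals 1.\<close>
    using insert.prems(1)[of 0] insert.hyps * by simp
  ultimately show ?case
    using insert.prems(2) by auto
qed simp

section \<open>Integration over the torus\<close>

lemma box_subset_torus: "box (\<chi> j. - pi) (\<chi> j. pi) \<subseteq> torus"
  by (auto simp: torus_def mem_box_cart less_imp_le)

lemma torus_subset_box: "torus \<subseteq> torus_box"
  by (auto simp: torus_def mem_box_cart less_imp_le)

lemma torus_borel: "torus \<in> sets borel"
proof -
  have "torus = (\<Inter>j\<in>UNIV. {\<theta>::real ^ 'a. - pi < \<theta> $ j} \<inter> {\<theta>. \<theta> $ j \<le> pi})"
    by (auto simp: torus_def)
  also have "\<dots> \<in> sets borel"
    by (intro sets.finite_INT sets.Int borel_open borel_closed open_Collect_less
        closed_Collect_le continuous_intros) auto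
  finally show ?thesis .
qed

text \<open>Passes from the Lebesgue integral of the definition to the gauge integral over a compact
  box, where continuity is enough for integrability. The domains differ only within the frontier of
  the box, which is negligible.\<close>

lemma torus_integral_eq:
  assumes "continuous_on UNIV F"
  shows "torus_integral F = (1 / (2 * pi)) ^ CARD('d) *\<^sub>R integral (torus_box :: (real ^ 'd::finite) set) F"
proof -
  have "set_integrable lborel (torus_box :: (real ^ 'd) set) F"
    unfolding set_integrable_def
    by (rule borel_integrable_compact) (auto intro: continuous_on_subset[OF assms])
  then have "set_integrable lborel torus F"
    by (rule set_integrable_subset) (use torus_subset_box torus_borel in auto)
  then have "(LINT \<theta>:torus|lborel. F \<theta>) = integral torus F"
    by (rule set_borel_integral_eq_integral)
  also have "\<dots> = integral torus_box F"
  proof (rule integral_spike_set)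
    show "negligible {x \<in> torus - torus_box. F x \<noteq> 0}"
      using torus_subset_box by (auto intro: negligible_subset[OF negligible_empty])
    show "negligible {x \<in> torus_box - torus. F x \<noteq> 0}"
      using box_subset_torus
      by (intro negligible_subset[OF negligible_frontier_interval[of "\<chi> j. - pi" "\<chi> j. pi"]]) auto
  qed
  finally show ?thesis
    by (simp add: torus_integral_def)
qed

lemma integrable_torus_box: "continuous_on UNIV F \<Longrightarrow> F integrable_on torus_box"
  for F :: "real ^ 'd::finite \<Rightarrow> 'b::banach"
  by (rule integrable_continuous) (auto intro: continuous_on_subset)

lemma torus_integral_mult:
  assumes "continuous_on UNIV F"
  shows "torus_integral (\<lambda>\<theta>. a * F \<theta>) = a * torus_integral F"
  using assms by (simp add: torus_integral_eq continuous_intros)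

lemma torus_integral_diff:
  assumes "continuous_on UNIV F" "continuous_on UNIV G"
  shows "torus_integral (\<lambda>\<theta>. F \<theta> - G \<theta>) = torus_integral F - torus_integral G"
  using assms
  by (simp add: torus_integral_eq integral_diff integrable_torus_box continuous_intros
      scaleR_diff_right)

lemma torus_integral_sum:
  assumes "\<And>i. i \<in> S \<Longrightarrow> continuous_on UNIV (F i)"
  shows "torus_integral (\<lambda>\<theta>. \<Sum>i\<in>S. F i \<theta>) = (\<Sum>i\<in>S. torus_integral (F i))"
proof (cases "finite S")
  case True
  then show ?thesis
    using assms
    by (simp add: torus_integral_eq integral_sum integrable_torus_box continuous_intros
      scaleR_sum_right)
qed (simp add: torus_integral_def)

lemma torus_integral_cnj: "torus_integral (\<lambda>\<theta>. cnj (F \<theta>)) = cnj (torus_integral F)"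
proof -
  have "torus_integral (\<lambda>\<theta>. cnj (F \<theta>)) = (1 / (2 * pi)) ^ CARD('a) *\<^sub>R
     (LINT x|lborel. cnj (indicator torus x *\<^sub>R F x))"
    by (simp add: torus_integral_def set_lebesgue_integral_def)
  also have "\<dots> = (1 / (2 * pi)) ^ CARD('a) *\<^sub>R cnj (LINT x|lborel. indicator torus x *\<^sub>R F x)"
    by (simp only: Bochner_Integration.integral_cnj)
  finally show ?thesis
    by (simp only: complex_cnj_scaleR torus_integral_def set_lebesgue_integral_def)
qed

text \<open>A jointly continuous integrand over a compact box has an integral continuous in the
  parameter.\<close>

lemma continuous_on_torus_integral:
  fixes F :: "'a::topological_space \<Rightarrow> real ^ 'd::finite \<Rightarrow> complex"
  assumes "continuous_on (U \<times> UNIV) (\<lambda>(x, \<theta>). F x \<theta>)"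
  shows "continuous_on U (\<lambda>x. torus_integral (F x))"
proof -
  have "continuous_on UNIV (F x)" if "x \<in> U" for x
  proof -
    have "continuous_on UNIV ((\<lambda>(x, \<theta>). F x \<theta>) \<circ> Pair x)"
      using that
      by (intro continuous_on_compose continuous_intros continuous_on_subset[OF assms]) auto
    then show ?thesis
      by (simp add: o_def)
  qed
  then have "continuous_on U (\<lambda>x. torus_integral (F x)) \<longleftrightarrow>
      continuous_on U (\<lambda>x. (1 / (2 * pi)) ^ CARD('d) *\<^sub>R integral torus_box (F x))"
    by (intro continuous_on_cong) (auto simp: torus_integral_eq)
  also have "\<dots>"
    by (intro continuous_intros integral_continuous_on_param continuous_on_subset[OF assms]) auto
  finally show ?thesis .
qed

lemma Re_torus_integral:
  assumes "continuous_on UNIV F"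
  shows "Re (torus_integral F) = (1 / (2 * pi)) ^ CARD('d) * integral (torus_box :: (real ^ 'd::finite) set) (\<lambda>\<theta>. Re (F \<theta>))"
proof -
  have "integral torus_box (Re \<circ> F) = Re (integral torus_box F)"
    by (rule integral_linear) (use assms in \<open>auto intro: integrable_torus_box bounded_linear_Re\<close>)
  then show ?thesis
    by (simp add: torus_integral_eq[OF assms] o_def)
qed

text \<open>The normalised measure is a probability measure, since the box has volume (2
  pi)^d.\<close>

lemma norm_torus_integral_le:
  fixes F :: "real ^ 'd::finite \<Rightarrow> complex"
  assumes "continuous_on UNIV F" "\<And>\<theta>. norm (F \<theta>) \<le> B"
  shows "norm (torus_integral F) \<le> B"
proof -
  have "norm (integral torus_box F) \<le> B * measure lborel (torus_box :: (real ^ 'd) set)"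
    using assms order_trans[OF norm_ge_zero assms(2)]
    by (intro integrable_bound integrable_torus_box) auto
  also have "measure lborel (torus_box :: (real ^ 'd) set) = (2 * pi) ^ CARD('d)"
    by (subst content_cbox_cart) (auto simp: interval_eq_empty_cart not_less)
  finally show ?thesis
    by (simp add: torus_integral_eq[OF assms(1)] field_simps)
qed

text \<open>The source of every strict inequality below: a continuous nonnegative function with zero
  integral over a box with interior vanishes on it.\<close>

lemma torus_integral_nonneg_eq_0:
  fixes F :: "real ^ 'd::finite \<Rightarrow> complex"
  assumes "continuous_on UNIV F" "\<And>\<theta>. 0 \<le> Re (F \<theta>)"
  shows "0 \<le> Re (torus_integral F)"
    and "Re (torus_integral F) = 0 \<Longrightarrow> \<theta> \<in> torus \<Longrightarrow> Re (F \<theta>) = 0"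
proof -
  have cont: "continuous_on S (\<lambda>\<theta>. Re (F \<theta>))" for S
    by (intro continuous_intros continuous_on_subset[OF assms(1)]) auto
  have int: "((\<lambda>\<theta>. Re (F \<theta>)) has_integral integral torus_box (\<lambda>\<theta>. Re (F \<theta>))) torus_box"
    by (intro integrable_integral integrable_torus_box cont)
  show "0 \<le> Re (torus_integral F)"
    unfolding Re_torus_integral[OF assms(1)]
    by (intro mult_nonneg_nonneg has_integral_nonneg[OF int] assms) auto
  assume "Re (torus_integral F) = 0" "\<theta> \<in> torus"
  then have "integral torus_box (\<lambda>\<theta>. Re (F \<theta>)) = 0"
    by (simp add: Re_torus_integral[OF assms(1)])
  then have "((\<lambda>\<theta>. Re (F \<theta>)) has_integral 0) torus_box"
    using int by simp
  moreover have "(0 :: real ^ 'd) \<in> box (\<chi> j. - pi) (\<chi> j. pi)"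
    by (simp add: mem_box_cart)
  ultimately show "Re (F \<theta>) = 0"
    using \<open>\<theta> \<in> torus\<close> torus_subset_box cont assms(2)
    by (intro has_integral_0_cbox_imp_0[of "\<chi> j. - pi" "\<chi> j. pi"]) auto
qed

section \<open>Trigonometric polynomials\<close>

lemma trig_poly_eq: "trig_poly ix p \<theta> = (\<Sum>l\<in>UNIV. p $ l * fourier_char (- ix l) \<theta>)"
  by (simp add: trig_poly_def fourier_char_minus)

lemma continuous_on_trig_poly [continuous_intros]:
  "continuous_on S f \<Longrightarrow> continuous_on S g \<Longrightarrow> continuous_on S (\<lambda>x. trig_poly ix (f x) (g x))"
  unfolding trig_poly_eq by (intro continuous_intros)

lemma trig_poly_diff: "trig_poly ix (p - q) \<theta> = trig_poly ix p \<theta> - trig_poly ix q \<theta>"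
  by (simp add: trig_poly_eq sum_subtractf algebra_simps)

lemma trig_poly_scaleR: "trig_poly ix (a *\<^sub>R p) \<theta> = of_real a * trig_poly ix p \<theta>"
  unfolding trig_poly_eq sum_distrib_left
  by (intro sum.cong) (simp_all add: scaleR_conv_of_real[where 'a=complex] mult_ac)

lemma norm_trig_poly_le:
  fixes p :: "complex ^ 'l::finite"
  shows "norm (trig_poly ix p \<theta>) \<le> CARD('l) * norm p"
proof -
  have "norm (trig_poly ix p \<theta>) \<le> (\<Sum>l\<in>UNIV. norm (p $ l))"
    unfolding trig_poly_eq by (rule order_trans[OF norm_sum]) (simp add: norm_mult)
  also have "\<dots> \<le> (\<Sum>l::'l\<in>UNIV. norm p)"
    by (intro sum_mono Finite_Cartesian_Product.norm_nth_le)
  finally show ?thesis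
    by simp
qed

text \<open>Periodicity carries facts about the half-open cube to all of the space. One
  representative serves every coefficient vector.\<close>

lemma trig_poly_torus_representative:
  fixes ix :: "'l::finite \<Rightarrow> int ^ 'd::finite"
  obtains \<phi> where "\<phi> \<in> torus" "\<And>p. trig_poly ix p \<phi> = trig_poly ix p \<theta>"
proof -
  obtain n :: "int ^ 'd" where "\<theta> + (\<chi> j. 2 * pi * of_int (n $ j)) \<in> torus"
    by (rule torus_representative)
  then show ?thesis
    by (rule that) (simp add: trig_poly_eq fourier_char_periodic)
qed

lemma subspace_herm_space: "subspace (herm_space ix)"
  unfolding herm_space_def by (rule subspaceI) auto

lemma closed_herm_space: "closed (herm_space ix)"
  by (rule closed_subspace[OF subspace_herm_space])

lemma P_plus_subset_herm_space: "P_plus ix \<subseteq> herm_space ix"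
  by (auto simp: P_plus_def)

lemma C_plus_subset_herm_space: "C_plus ix \<subseteq> herm_space ix"
  by (auto simp: C_plus_def)

lemma P_plus_pos: "p \<in> P_plus ix \<Longrightarrow> 0 < Re (trig_poly ix p \<theta>)"
  by (rule trig_poly_torus_representative[of ix \<theta>]) (auto simp: P_plus_def)

lemma P_plus_nonzero: "p \<in> P_plus ix \<Longrightarrow> trig_poly ix p \<theta> \<noteq> 0"
  using P_plus_pos[of p ix \<theta>] by auto

text \<open>Hermitian symmetry and nonnegativity at a point are closed conditions.\<close>

lemma closure_P_plus:
  assumes "p \<in> closure (P_plus ix)"
  shows "p \<in> herm_space ix" "0 \<le> Re (trig_poly ix p \<theta>)"
proof -
  have "closed (herm_space ix \<inter> {p. 0 \<le> Re (trig_poly ix p \<theta>)})"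
    by (intro closed_Int closed_herm_space closed_Collect_le continuous_intros)
  moreover have "P_plus ix \<subseteq> herm_space ix \<inter> {p. 0 \<le> Re (trig_poly ix p \<theta>)}"
    using P_plus_subset_herm_space by (auto simp: P_plus_pos less_imp_le)
  ultimately have "closure (P_plus ix) \<subseteq> herm_space ix \<inter> {p. 0 \<le> Re (trig_poly ix p \<theta>)}"
    by (intro closure_minimal)
  then show "p \<in> herm_space ix" "0 \<le> Re (trig_poly ix p \<theta>)"
    using assms by auto
qed

lemma P_plus_scaleR: "p \<in> P_plus ix \<Longrightarrow> 0 < a \<Longrightarrow> a *\<^sub>R p \<in> P_plus ix"
  using subspace_scale[OF subspace_herm_space]
  by (auto simp: P_plus_def trig_poly_scaleR)

text \<open>The minimum is attained on the compact box, is positive there, and bounds all values by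
  periodicity.\<close>

lemma P_plus_lower_bound:
  fixes ix :: "'l::finite \<Rightarrow> int ^ 'd::finite"
  assumes "p \<in> P_plus ix"
  obtains \<delta> where "0 < \<delta>" "\<And>\<theta>. \<delta> \<le> Re (trig_poly ix p \<theta>)"
proof -
  have "(0 :: real ^ 'd) \<in> torus_box"
    by (simp add: mem_box_cart)
  then have "\<exists>x\<in>torus_box. \<forall>\<theta>\<in>torus_box. Re (trig_poly ix p x) \<le> Re (trig_poly ix p \<theta>)"
    by (intro continuous_attains_inf continuous_intros) auto
  then obtain \<theta>\<^sub>0 :: "real ^ 'd" where
    \<theta>\<^sub>0: "\<And>\<theta>. \<theta> \<in> torus_box \<Longrightarrow> Re (trig_poly ix p \<theta>\<^sub>0) \<le> Re (trig_poly ix p \<theta>)"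
    by blast
  have "Re (trig_poly ix p \<theta>\<^sub>0) \<le> Re (trig_poly ix p \<theta>)" for \<theta>
    using torus_subset_box by (rule_tac trig_poly_torus_representative[of ix \<theta>]) (use \<theta>\<^sub>0 in force)
  then show ?thesis
    by (rule that[OF P_plus_pos[OF assms]])
qed

lemma openin_P_plus: "openin (top_of_set (herm_space ix)) (P_plus ix)"
  for ix :: "'l::finite \<Rightarrow> int ^ 'd::finite"
  unfolding openin_euclidean_subtopology_iff
proof (intro conjI ballI P_plus_subset_herm_space)
  fix p assume "p \<in> P_plus ix"
  then obtain \<delta> where \<delta>: "0 < \<delta>" "\<And>\<theta>. \<delta> \<le> Re (trig_poly ix p \<theta>)"
    using P_plus_lower_bound by metis
  show "\<exists>e>0. \<forall>q\<in>herm_space ix. dist q p < e \<longrightarrow> q \<in> P_plus ix"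
  \<comment> \<open>A coefficient perturbation of norm \<open>e\<close> changes values by at most
    \<open>CARD('l) * e\<close>, so this radius keeps the change below the minimum \<delta>.\<close>
  proof (intro exI[of _ "\<delta> / CARD('l)"] conjI ballI impI)
    fix q assume q: "q \<in> herm_space ix" "dist q p < \<delta> / CARD('l)"
    have "0 < Re (trig_poly ix q \<theta>)" for \<theta>
    proof -
      have "norm (trig_poly ix (p - q) \<theta>) \<le> CARD('l) * norm (p - q)"
        by (rule norm_trig_poly_le)
      also have "\<dots> < \<delta>"
        using q(2) by (simp add: field_simps dist_norm norm_minus_commute)
      finally have "Re (trig_poly ix p \<theta> - trig_poly ix q \<theta>) < \<delta>"
        using complex_Re_le_cmod le_less_trans trig_poly_diff by metis
      then show ?thesis
        using \<delta>(2)[of \<theta>] by simp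
    qed
    then show "q \<in> P_plus ix"
      using q by (auto simp: P_plus_def)
  qed (use \<delta> in simp)
qed

section \<open>The coefficient pairing and the dual cone\<close>

lemma coeff_inner_add_left: "coeff_inner (c + c') p = coeff_inner c p + coeff_inner c' p"
  by (simp add: coeff_inner_def sum.distrib algebra_simps)

lemma coeff_inner_diff_left: "coeff_inner (c - c') p = coeff_inner c p - coeff_inner c' p"
  by (simp add: coeff_inner_def sum_subtractf algebra_simps)

lemma coeff_inner_scaleR_left: "coeff_inner (a *\<^sub>R c) p = a *\<^sub>R coeff_inner c p"
  by (simp add: coeff_inner_def scaleR_sum_right)

lemma coeff_inner_scaleR_right: "coeff_inner c (a *\<^sub>R p) = a *\<^sub>R coeff_inner c p"
  by (simp add: coeff_inner_def scaleR_sum_right)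

lemma continuous_on_coeff_inner [continuous_intros]:
  "continuous_on S f \<Longrightarrow> continuous_on S g \<Longrightarrow> continuous_on S (\<lambda>x. coeff_inner (f x) (g x))"
  unfolding coeff_inner_def by (intro continuous_intros)

lemma norm_coeff_inner_le:
  fixes c p :: "complex ^ 'l::finite"
  shows "norm (coeff_inner c p) \<le> CARD('l) * (norm c * norm p)"
proof -
  have "norm (coeff_inner c p) \<le> (\<Sum>l\<in>UNIV. norm (c $ l) * norm (p $ l))"
    unfolding coeff_inner_def by (rule order_trans[OF norm_sum]) (simp add: norm_mult)
  also have "\<dots> \<le> (\<Sum>l::'l\<in>UNIV. norm c * norm p)"
    by (intro sum_mono mult_mono Finite_Cartesian_Product.norm_nth_le) auto
  finally show ?thesis
    by simp
qed

text \<open>Convexity supplies the connectedness behind the surjectivity of the moment map.\<close>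

lemma convex_C_plus: "convex (C_plus ix)"
proof (rule convexI)
  fix x y :: "complex ^ 'a" and u v :: real
  assume xy: "x \<in> C_plus ix" "y \<in> C_plus ix" and uv: "0 \<le> u" "0 \<le> v" "u + v = 1"
  have "u *\<^sub>R x + v *\<^sub>R y \<in> herm_space ix"
    using xy C_plus_subset_herm_space
    by (blast intro: subspace_add subspace_scale subspace_herm_space)
  moreover have "0 < Re (coeff_inner (u *\<^sub>R x + v *\<^sub>R y) p)"
    if p: "p \<in> closure (P_plus ix) - {0}" for p
  proof -
    have "0 < Re (coeff_inner x p)" "0 < Re (coeff_inner y p)"
      using xy p by (auto simp: C_plus_def)
    moreover have "0 < u \<or> 0 < v"
      using uv by linarith
    ultimately show ?thesis
      using uv
      by (auto simp: coeff_inner_add_left coeff_inner_scaleR_left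
          intro: add_pos_nonneg add_nonneg_pos)
  qed
  ultimately show "u *\<^sub>R x + v *\<^sub>R y \<in> C_plus ix"
    by (auto simp: C_plus_def)
qed

section \<open>Moment matrices\<close>

text \<open>A Toeplitz-type matrix: entries depend only on \<open>ix k - ix l\<close>. It sends the
  coefficients of a polynomial R to the moments of \<open>R * w\<close>.\<close>

definition weight_matrix ::
  "('l::finite \<Rightarrow> int ^ 'd::finite) \<Rightarrow> (real ^ 'd \<Rightarrow> complex) \<Rightarrow> complex ^ 'l ^ 'l" where
  "weight_matrix ix w = (\<chi> k l. torus_integral (\<lambda>\<theta>. fourier_char (ix k - ix l) \<theta> * w \<theta>))"

lemma weight_matrix_mult:
  fixes ix :: "'l::finite \<Rightarrow> int ^ 'd::finite"
  assumes "continuous_on UNIV w"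
  shows "weight_matrix ix w *v r =
    (\<chi> k. torus_integral (\<lambda>\<theta>. fourier_char (ix k) \<theta> * (trig_poly ix r \<theta> * w \<theta>)))"
proof -
  have "(\<Sum>l\<in>UNIV. torus_integral (\<lambda>\<theta>. fourier_char (ix k - ix l) \<theta> * w \<theta>) * r $ l) =
      torus_integral (\<lambda>\<theta>. fourier_char (ix k) \<theta> * (trig_poly ix r \<theta> * w \<theta>))" for k
  proof -
    have "(\<Sum>l\<in>UNIV. torus_integral (\<lambda>\<theta>. fourier_char (ix k - ix l) \<theta> * w \<theta>) * r $ l) =
        (\<Sum>l\<in>UNIV. torus_integral (\<lambda>\<theta>. r $ l * (fourier_char (ix k - ix l) \<theta> * w \<theta>)))"
      using assms by (intro sum.cong) (simp_all add: torus_integral_mult continuous_intros)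
    also have "\<dots> = torus_integral (\<lambda>\<theta>. \<Sum>l\<in>UNIV. r $ l * (fourier_char (ix k - ix l) \<theta> * w \<theta>))"
      by (rule torus_integral_sum[symmetric]) (intro continuous_intros assms)
    also have "(\<lambda>\<theta>. \<Sum>l\<in>UNIV. r $ l * (fourier_char (ix k - ix l) \<theta> * w \<theta>)) =
        (\<lambda>\<theta>. fourier_char (ix k) \<theta> * (trig_poly ix r \<theta> * w \<theta>))"
      by (simp add: fun_eq_iff fourier_char_diff trig_poly_eq sum_distrib_left sum_distrib_right mult_ac)
    finally show ?thesis .
  qed
  then show ?thesis
    by (simp add: weight_matrix_def matrix_vector_mult_def)
qed

text \<open>Conjugating R turns its exponents \<open>- ix k\<close> into \<open>ix k\<close>, so the
  pairing recombines the moments into one integral.\<close>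

lemma coeff_inner_moments:
  fixes ix :: "'l::finite \<Rightarrow> int ^ 'd::finite"
  assumes "continuous_on UNIV F"
  shows "coeff_inner (\<chi> k. torus_integral (\<lambda>\<theta>. fourier_char (ix k) \<theta> * F \<theta>)) r =
    torus_integral (\<lambda>\<theta>. F \<theta> * cnj (trig_poly ix r \<theta>))"
proof -
  have "coeff_inner (\<chi> k. torus_integral (\<lambda>\<theta>. fourier_char (ix k) \<theta> * F \<theta>)) r =
      (\<Sum>k\<in>UNIV. torus_integral (\<lambda>\<theta>. cnj (r $ k) * (fourier_char (ix k) \<theta> * F \<theta>)))"
    using assms unfolding coeff_inner_def
    by (intro sum.cong) (simp_all add: torus_integral_mult continuous_intros)
  also have "\<dots> = torus_integral (\<lambda>\<theta>. \<Sum>k\<in>UNIV. cnj (r $ k) * (fourier_char (ix k) \<theta> * F \<theta>))"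
    by (rule torus_integral_sum[symmetric]) (intro continuous_intros assms)
  also have "(\<lambda>\<theta>. \<Sum>k\<in>UNIV. cnj (r $ k) * (fourier_char (ix k) \<theta> * F \<theta>)) =
      (\<lambda>\<theta>. F \<theta> * cnj (trig_poly ix r \<theta>))"
    by (simp add: fun_eq_iff trig_poly_eq sum_distrib_left cnj_fourier_char mult_ac)
  finally show ?thesis .
qed

lemma moment_map_eq_moments:
  "moment_map ix p q =
    (\<chi> k. torus_integral (\<lambda>\<theta>. fourier_char (ix k) \<theta> * (trig_poly ix p \<theta> / trig_poly ix q \<theta>)))"
  by (simp add: moment_map_def fourier_char_def)

lemma continuous_on_inverse_P_plus [continuous_intros]:
  assumes "continuous_on S f" "continuous_on S g" "\<And>x. x \<in> S \<Longrightarrow> f x \<in> P_plus ix"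
  shows "continuous_on S (\<lambda>x. inverse (trig_poly ix (f x) (g x)))"
  using assms by (intro continuous_intros ballI) (simp_all add: P_plus_nonzero)

text \<open>For fixed \<open>q\<close> the moment map is linear in \<open>p\<close>; all
  nonlinearity sits in \<open>q\<close>.\<close>

lemma moment_map_eq_weight_matrix:
  assumes "q \<in> P_plus ix"
  shows "moment_map ix p q = weight_matrix ix (\<lambda>\<theta>. inverse (trig_poly ix q \<theta>)) *v p"
  using assms
  by (subst weight_matrix_mult) (simp_all add: moment_map_eq_moments divide_inverse continuous_intros)

lemma coeff_inner_moment_map:
  assumes "q \<in> P_plus ix"
  shows "coeff_inner (moment_map ix p q) r =
    torus_integral (\<lambda>\<theta>. trig_poly ix p \<theta> / trig_poly ix q \<theta> * cnj (trig_poly ix r \<theta>))"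
  using assms unfolding moment_map_eq_moments
  by (subst coeff_inner_moments) (simp_all add: divide_inverse continuous_intros)

text \<open>
  On the solution set of \<open>moment_map ix p q = c\<close> the increments of \<open>p\<close> and \<open>q\<close> are exactly linearly
  related, because \<open>(P' - P) / Q' = P (Q' - Q) / (Q Q') + (P' / Q' - P / Q)\<close>.
\<close>

lemma moment_map_increment:
  assumes "q \<in> P_plus ix" "q' \<in> P_plus ix" "moment_map ix p q = moment_map ix p' q'"
  shows "weight_matrix ix (\<lambda>\<theta>. inverse (trig_poly ix q' \<theta>)) *v (p' - p) =
    weight_matrix ix (\<lambda>\<theta>. trig_poly ix p \<theta> * inverse (trig_poly ix q \<theta>) * inverse (trig_poly ix q' \<theta>))
      *v (q' - q)"
proof -
  let ?P = "trig_poly ix p" and ?P' = "trig_poly ix p'"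
  let ?Q = "trig_poly ix q" and ?Q' = "trig_poly ix q'"
  note nz = P_plus_nonzero[OF assms(1)] P_plus_nonzero[OF assms(2)]
  have cont: "continuous_on UNIV (\<lambda>\<theta>. fourier_char k \<theta> * (trig_poly ix r \<theta> / ?Q \<theta>))"
    "continuous_on UNIV (\<lambda>\<theta>. fourier_char k \<theta> * (trig_poly ix r \<theta> / ?Q' \<theta>))" for r k
    using nz unfolding divide_inverse by (auto intro!: continuous_intros)
  have "torus_integral (\<lambda>\<theta>. fourier_char (ix k) \<theta> * (trig_poly ix (p' - p) \<theta> * inverse (?Q' \<theta>))) =
      torus_integral (\<lambda>\<theta>. fourier_char (ix k) \<theta> * (trig_poly ix (q' - q) \<theta> * (?P \<theta> * inverse (?Q \<theta>) * inverse (?Q' \<theta>))))"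
    for k
  proof -
    let ?I = "\<lambda>r Q. torus_integral (\<lambda>\<theta>. fourier_char (ix k) \<theta> * (r \<theta> / Q \<theta>))"
    have "(\<lambda>\<theta>. fourier_char (ix k) \<theta> * (trig_poly ix (p' - p) \<theta> * inverse (?Q' \<theta>))) =
        (\<lambda>\<theta>. fourier_char (ix k) \<theta> * (?P' \<theta> / ?Q' \<theta>) - fourier_char (ix k) \<theta> * (?P \<theta> / ?Q' \<theta>))"
      by (simp add: trig_poly_diff divide_inverse algebra_simps)
    then have "torus_integral (\<lambda>\<theta>. fourier_char (ix k) \<theta> * (trig_poly ix (p' - p) \<theta> * inverse (?Q' \<theta>))) =
        ?I ?P' ?Q' - ?I ?P ?Q'"
      by (simp only: torus_integral_diff[OF cont(2) cont(2)])
    \<comment> \<open>Equality of the moments of both pairs enters here. Both sides thereby become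
      the moments of P / Q minus those of P / Q'.\<close>
    moreover have "?I ?P' ?Q' = ?I ?P ?Q"
      using arg_cong[OF assms(3), of "\<lambda>x. x $ k"] by (simp add: moment_map_eq_moments)
    moreover have "(\<lambda>\<theta>. fourier_char (ix k) \<theta> * (trig_poly ix (q' - q) \<theta> * (?P \<theta> * inverse (?Q \<theta>) * inverse (?Q' \<theta>)))) =
        (\<lambda>\<theta>. fourier_char (ix k) \<theta> * (?P \<theta> / ?Q \<theta>) - fourier_char (ix k) \<theta> * (?P \<theta> / ?Q' \<theta>))"
      using nz by (simp add: trig_poly_diff fun_eq_iff field_simps)
    then have "torus_integral (\<lambda>\<theta>. fourier_char (ix k) \<theta> * (trig_poly ix (q' - q) \<theta> * (?P \<theta> * inverse (?Q \<theta>) * inverse (?Q' \<theta>)))) =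
        ?I ?P ?Q - ?I ?P ?Q'"
      by (simp only: torus_integral_diff[OF cont(1) cont(2)])
    ultimately show ?thesis
      by simp
  qed
  then show ?thesis
    using nz
    by (subst (1 2) weight_matrix_mult) (auto intro!: continuous_intros simp: vec_eq_iff)
qed

section \<open>Symmetric index sets, positive definiteness and injectivity\<close>

locale symmetric_index =
  fixes ix :: "'l::finite \<Rightarrow> int ^ 'd::finite"
  assumes inj_ix: "inj ix"
    and ex_neg_ix: "\<exists>m. ix m = - ix l"
    and ex_zero_ix: "\<exists>l. ix l = 0"
begin

text \<open>Negation of exponents pulled back to the enumerating type; injectivity of
  \<open>ix\<close> makes it an involution.\<close>

definition neg :: "'l \<Rightarrow> 'l" where
  "neg l = (SOME m. ix m = - ix l)"

lemma ix_neg: "ix (neg l) = - ix l"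
  unfolding neg_def by (rule someI_ex[OF ex_neg_ix])

lemma neg_neg [simp]: "neg (neg l) = l"
  using inj_ix by (simp add: ix_neg inj_def)

lemma bij_neg: "bij neg"
  by (rule o_bij[of neg]) auto

lemma herm_space_neg: "p \<in> herm_space ix \<Longrightarrow> p $ neg l = cnj (p $ l)"
  by (simp add: herm_space_def ix_neg)

lemma herm_spaceI:
  assumes "\<And>l. r $ neg l = cnj (r $ l)"
  shows "r \<in> herm_space ix"
  using assms inj_ix by (auto simp: herm_space_def ix_neg inj_def) (metis ix_neg)

lemma cnj_trig_poly:
  assumes "p \<in> herm_space ix"
  shows "cnj (trig_poly ix p \<theta>) = trig_poly ix p \<theta>"
proof -
  have "cnj (trig_poly ix p \<theta>) = (\<Sum>l\<in>UNIV. p $ neg l * fourier_char (- ix (neg l)) \<theta>)"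
    by (simp add: trig_poly_eq cnj_fourier_char herm_space_neg[OF assms] ix_neg)
  also have "\<dots> = trig_poly ix p \<theta>"
    unfolding trig_poly_eq by (rule sum.reindex_bij_betw[OF bij_neg])
  finally show ?thesis .
qed

lemma Im_trig_poly: "p \<in> herm_space ix \<Longrightarrow> Im (trig_poly ix p \<theta>) = 0"
  using cnj_trig_poly[of p \<theta>] by (simp add: complex_eq_iff)

lemma trig_poly_of_real: "p \<in> herm_space ix \<Longrightarrow> trig_poly ix p \<theta> = of_real (Re (trig_poly ix p \<theta>))"
  by (simp add: complex_eq_iff Im_trig_poly)

text \<open>Linear independence of characters, with the coefficients reindexed by the distinct
  exponents \<open>- ix l\<close>.\<close>

lemma trig_poly_eq_0:
  assumes "\<And>\<theta>. \<theta> \<in> torus \<Longrightarrow> trig_poly ix p \<theta> = 0"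
  shows "p = 0"
proof -
  have inj: "inj (\<lambda>l. - ix l)"
    using inj_ix by (simp add: inj_def)
  have *: "(\<Sum>k\<in>range (\<lambda>l. - ix l). p $ (inv (\<lambda>l. - ix l) k) * fourier_char k \<theta>) = 0" for \<theta>
  proof -
    have "(\<Sum>k\<in>range (\<lambda>l. - ix l). p $ (inv (\<lambda>l. - ix l) k) * fourier_char k \<theta>) = trig_poly ix p \<theta>"
      by (simp add: sum.reindex[OF inj] trig_poly_eq inv_f_f[OF inj])
    also have "\<dots> = 0"
      by (rule trig_poly_torus_representative[of ix \<theta>]) (metis assms)
    finally show ?thesis .
  qed
  have "p $ l = 0" for l
    using fourier_char_independent[OF _ *, of "- ix l"] by (simp add: inv_f_f[OF inj])
  then show ?thesis
    by (simp add: vec_eq_iff)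
qed

text \<open>Positive definiteness: the quadratic form at \<open>r\<close> is the integral of w
  |R|^2. If it vanishes, then R vanishes on the torus and so do its coefficients.\<close>

lemma weight_matrix_mult_eq_0:
  assumes w: "continuous_on UNIV w" "\<And>\<theta>. Im (w \<theta>) = 0" "\<And>\<theta>. 0 < Re (w \<theta>)"
    and "weight_matrix ix w *v r = 0"
  shows "r = 0"
proof (rule trig_poly_eq_0)
  fix \<theta> :: "real ^ 'd" assume "\<theta> \<in> torus"
  let ?F = "\<lambda>\<theta>. trig_poly ix r \<theta> * w \<theta> * cnj (trig_poly ix r \<theta>)"
  have "torus_integral ?F = coeff_inner (weight_matrix ix w *v r) r"
    by (simp add: weight_matrix_mult coeff_inner_moments continuous_intros w)
  then have "Re (torus_integral ?F) = 0"
    using assms(4) by (simp add: coeff_inner_def)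
  moreover have F: "Re (?F \<theta>) = Re (w \<theta>) * (cmod (trig_poly ix r \<theta>))\<^sup>2" for \<theta>
    unfolding cmod_power2 by (simp add: power2_eq_square algebra_simps w(2))
  ultimately have "Re (w \<theta>) * (cmod (trig_poly ix r \<theta>))\<^sup>2 = 0"
    using torus_integral_nonneg_eq_0(2)[of ?F \<theta>] \<open>\<theta> \<in> torus\<close> w
    by (simp add: continuous_intros less_imp_le)
  then show "trig_poly ix r \<theta> = 0"
    using w(3)[of \<theta>] by simp
qed

lemma det_weight_matrix:
  assumes w: "continuous_on UNIV w" "\<And>\<theta>. Im (w \<theta>) = 0" "\<And>\<theta>. 0 < Re (w \<theta>)"
  shows "det (weight_matrix ix w) \<noteq> 0"
proof -
  have "\<exists>B. B ** weight_matrix ix w = mat 1"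
    using weight_matrix_mult_eq_0[OF w] by (simp add: matrix_left_invertible_ker)
  then show ?thesis
    by (metis invertible_det_nz invertible_left_inverse)
qed

text \<open>The derivative of the moment map in its first argument.\<close>

definition resolvent_weight :: "complex ^ 'l \<Rightarrow> complex ^ 'l ^ 'l" where
  "resolvent_weight q = weight_matrix ix (\<lambda>\<theta>. inverse (trig_poly ix q \<theta>))"

text \<open>A difference quotient in the second argument: for \<open>q' = q\<close> it is minus the
  derivative of the moment map in \<open>q\<close>.\<close>

definition increment_weight :: "complex ^ 'l \<Rightarrow> complex ^ 'l \<Rightarrow> complex ^ 'l \<Rightarrow> complex ^ 'l ^ 'l" where
  "increment_weight p q q' = weight_matrix ix
     (\<lambda>\<theta>. trig_poly ix p \<theta> * inverse (trig_poly ix q \<theta>) * inverse (trig_poly ix q' \<theta>))"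

lemma Re_Im_inverse_P_plus:
  assumes "q \<in> P_plus ix"
  shows "Im (inverse (trig_poly ix q \<theta>)) = 0" "0 < Re (inverse (trig_poly ix q \<theta>))"
  using trig_poly_of_real[of q \<theta>] P_plus_pos[OF assms, of \<theta>] P_plus_subset_herm_space[of ix] assms
  by (auto simp: subset_iff Im_trig_poly power2_eq_square)

lemma det_resolvent_weight: "q \<in> P_plus ix \<Longrightarrow> det (resolvent_weight q) \<noteq> 0"
  unfolding resolvent_weight_def
  by (intro det_weight_matrix continuous_intros) (simp_all add: Re_Im_inverse_P_plus del: inverse_complex.sel)

lemma det_increment_weight:
  assumes "p \<in> P_plus ix" "q \<in> P_plus ix" "q' \<in> P_plus ix"
  shows "det (increment_weight p q q') \<noteq> 0"
  unfolding increment_weight_def using assms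
  by (intro det_weight_matrix continuous_intros)
    (auto simp: Re_Im_inverse_P_plus P_plus_pos Im_trig_poly P_plus_subset_herm_space[THEN subsetD]
      simp del: inverse_complex.sel)

text \<open>For equal first arguments the increment identity says that an invertible matrix
  annihilates \<open>q' - q\<close>.\<close>

lemma inj_on_moment_map:
  assumes "p \<in> P_plus ix"
  shows "inj_on (moment_map ix p) (P_plus ix)"
proof (rule inj_onI)
  fix q q' assume q: "q \<in> P_plus ix" "q' \<in> P_plus ix" "moment_map ix p q = moment_map ix p q'"
  then have "increment_weight p q q' *v (q' - q) = 0"
    using moment_map_increment[OF q] by (simp add: increment_weight_def)
  moreover have "invertible (increment_weight p q q')"
    using det_increment_weight[OF assms q(1,2)] by (simp add: invertible_det_nz)
  ultimately have "q' - q = 0"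
    by (metis invertible_left_inverse matrix_left_invertible_ker)
  then show "q = q'"
    by simp
qed

text \<open>The mirror image, with \<open>p' - p\<close> annihilated; it makes \<open>g_map\<close>
  injective.\<close>

lemma moment_map_inj_left:
  assumes "q \<in> P_plus ix" "moment_map ix p q = moment_map ix p' q"
  shows "p = p'"
proof -
  have "resolvent_weight q *v (p' - p) = 0"
    using moment_map_increment[OF assms(1) assms] by (simp add: resolvent_weight_def)
  moreover have "invertible (resolvent_weight q)"
    using det_resolvent_weight[OF assms(1)] by (simp add: invertible_det_nz)
  ultimately have "p' - p = 0"
    by (metis invertible_left_inverse matrix_left_invertible_ker)
  then show ?thesis
    by simp
qed

lemma moment_map_in_herm_space:
  assumes "p \<in> herm_space ix" "q \<in> herm_space ix"
  shows "moment_map ix p q \<in> herm_space ix"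
proof (rule herm_spaceI)
  fix l
  have "cnj (fourier_char (ix l) \<theta> * (trig_poly ix p \<theta> / trig_poly ix q \<theta>)) =
      fourier_char (ix (neg l)) \<theta> * (trig_poly ix p \<theta> / trig_poly ix q \<theta>)" for \<theta>
    using assms by (simp add: cnj_fourier_char ix_neg cnj_trig_poly)
  then show "moment_map ix p q $ neg l = cnj (moment_map ix p q $ l)"
    by (simp add: moment_map_eq_moments flip: torus_integral_cnj)
qed

text \<open>Pairing with \<open>r\<close> gives the integral of P R / Q, which is nonnegative; were
  it zero, R would vanish on the torus.\<close>

lemma moment_map_in_C_plus:
  assumes p: "p \<in> P_plus ix" and q: "q \<in> P_plus ix"
  shows "moment_map ix p q \<in> C_plus ix"
proof -
  have herm: "p \<in> herm_space ix" "q \<in> herm_space ix"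
    using p q P_plus_subset_herm_space by auto
  have "0 < Re (coeff_inner (moment_map ix p q) r)" if r: "r \<in> closure (P_plus ix) - {0}" for r
  proof -
    let ?F = "\<lambda>\<theta>. trig_poly ix p \<theta> / trig_poly ix q \<theta> * cnj (trig_poly ix r \<theta>)"
    have cont: "continuous_on UNIV ?F"
      unfolding divide_inverse by (intro continuous_intros q)
    have r': "r \<in> herm_space ix" "\<And>\<theta>. 0 \<le> Re (trig_poly ix r \<theta>)"
      using r closure_P_plus by auto
    have F: "Re (?F \<theta>) = Re (trig_poly ix p \<theta>) / Re (trig_poly ix q \<theta>) * Re (trig_poly ix r \<theta>)" for \<theta>
      by (subst (1 2 3) trig_poly_of_real) (use herm r' in simp_all)
    have nonneg: "0 \<le> Re (?F \<theta>)" for \<theta>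
      unfolding F using P_plus_pos[OF p] P_plus_pos[OF q] r'(2) by (simp add: less_imp_le)
    have "Re (torus_integral ?F) \<noteq> 0"
    proof
      assume "Re (torus_integral ?F) = 0"
      then have "Re (?F \<theta>) = 0" if "\<theta> \<in> torus" for \<theta>
        using torus_integral_nonneg_eq_0(2)[OF cont nonneg _ that] by simp
      then have "trig_poly ix r \<theta> = 0" if "\<theta> \<in> torus" for \<theta>
        using that P_plus_pos[OF p, of \<theta>] P_plus_pos[OF q, of \<theta>] trig_poly_of_real[OF r'(1), of \<theta>]
        unfolding F by (metis less_irrefl divide_eq_0_iff mult_eq_0_iff of_real_0)
      then show False
        using trig_poly_eq_0 r by blast
    qed
    then show ?thesis
      using torus_integral_nonneg_eq_0(1)[OF cont nonneg]
      by (simp add: coeff_inner_moment_map[OF q])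
  qed
  then show ?thesis
    using moment_map_in_herm_space[OF herm] by (auto simp: C_plus_def)
qed

lemma P_plus_nonempty: "P_plus ix \<noteq> {}"
proof -
  obtain z where z: "ix z = 0"
    using ex_zero_ix by blast
  \<comment> \<open>The witness is the constant polynomial 1, available because 0 is an
    exponent.\<close>
  have "trig_poly ix (axis z 1) \<theta> = 1" for \<theta>
    by (simp add: trig_poly_eq axis_def z if_distrib[of "\<lambda>x. x * _"] sum.delta cong: if_cong)
  moreover have "axis z 1 \<in> herm_space ix"
  proof (rule herm_spaceI)
    fix l
    have "neg l = z \<longleftrightarrow> l = z"
      by (metis ix_neg inj_ix injD neg_equal_zero z neg_neg neg_0_equal_iff_equal)
    then show "(axis z 1 :: complex ^ 'l) $ neg l = cnj (axis z 1 $ l)"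
      by (simp add: axis_def)
  qed
  ultimately have "axis z 1 \<in> P_plus ix"
    by (simp add: P_plus_def)
  then show ?thesis
    by blast
qed

end

section \<open>Properness of the moment map\<close>

text \<open>Layers of height \<open>4 ^ k\<close> grow geometrically, so the highest layer over
  \<open>x\<close> dominates the sum, and the bound on \<open>f\<close> from that layer offsets it,
  uniformly in \<open>K\<close>.\<close>

lemma geometric_layers:
  fixes f C :: real
  assumes "0 \<le> f" "0 \<le> C" "\<And>k. x \<in> B k \<Longrightarrow> f \<le> C / 4 ^ k"
  shows "(\<Sum>k<K. if x \<in> B k then 4 ^ k else 0) \<le> (4::real) ^ K / 3"
    and "f * (\<Sum>k<K. if x \<in> B k then 4 ^ k else 0) \<le> 4 / 3 * C"
proof -
  show *: "(\<Sum>k<K. if x \<in> B k then 4 ^ k else 0) \<le> (4::real) ^ K / 3" for K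
  proof (induction K)
    case (Suc K)
    have "(\<Sum>k<Suc K. if x \<in> B k then 4 ^ k else 0) \<le> (4::real) ^ K / 3 + 4 ^ K"
      unfolding sum.lessThan_Suc by (intro add_mono Suc.IH) auto
    then show ?case
      by simp
  qed simp
  show "f * (\<Sum>k<K. if x \<in> B k then 4 ^ k else 0) \<le> 4 / 3 * C"
  proof (induction K)
    case (Suc K)
    show ?case
    proof (cases "x \<in> B K")
      case True
      \<comment> \<open>The bound from the newest layer is played against the whole sum; the product
        is 4/3 C.\<close>
      have "f * (\<Sum>k<Suc K. if x \<in> B k then 4 ^ k else 0) \<le> C / 4 ^ K * (4 ^ Suc K / 3)"
        by (intro mult_mono * assms True sum_nonneg) (use assms in auto)
      then show ?thesis
        by simp
    qed (use Suc in simp)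
  qed (use assms in simp)
qed

text \<open>A cube with vertex \<theta> pointing inwards in each coordinate, so that it stays in
  \<open>torus_box\<close> even when \<theta> lies near the boundary.\<close>

definition corner_box :: "real ^ 'd::finite \<Rightarrow> real \<Rightarrow> (real ^ 'd) set" where
  "corner_box \<theta> h = cbox (\<chi> j. if 0 < \<theta> $ j then \<theta> $ j - h else \<theta> $ j)
                         (\<chi> j. if 0 < \<theta> $ j then \<theta> $ j else \<theta> $ j + h)"

lemma corner_box_subset:
  assumes "\<theta> \<in> torus" "h \<le> 1"
  shows "corner_box \<theta> h \<subseteq> torus_box"
proof
  fix x assume "x \<in> corner_box \<theta> h"
  then have "(if 0 < \<theta> $ j then \<theta> $ j - h else \<theta> $ j) \<le> x $ j \<and>
      x $ j \<le> (if 0 < \<theta> $ j then \<theta> $ j else \<theta> $ j + h)" for j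
    by (auto simp: corner_box_def mem_box_cart)
  moreover have "- pi < \<theta> $ j" "\<theta> $ j \<le> pi" for j
    using assms by (auto simp: torus_def)
  ultimately have "- pi \<le> x $ j \<and> x $ j \<le> pi" for j
    using assms(2) pi_gt3 by (smt (verit, best))
  then show "x \<in> torus_box"
    by (simp add: mem_box_cart)
qed

lemma corner_box_dist: "x \<in> corner_box \<theta> h \<Longrightarrow> \<bar>(x - \<theta>) $ j\<bar> \<le> h"
  by (auto simp: corner_box_def mem_box_cart split: if_splits dest!: spec[of _ j])

lemma measure_corner_box:
  fixes \<theta> :: "real ^ 'd::finite"
  assumes "0 \<le> h"
  shows "measure lborel (corner_box \<theta> h) = h ^ CARD('d)"
proof -
  have "measure lborel (corner_box \<theta> h) = (\<Prod>j::'d\<in>UNIV. h)"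
    unfolding corner_box_def using assms
    by (subst content_cbox_cart)
      (auto simp: interval_eq_empty_cart not_less simp del: prod_constant intro!: prod.cong split: if_splits)
  then show ?thesis
    by simp
qed

text \<open>
  A nonnegative function vanishing to second order at a point is not reciprocally integrable in
  dimension at most 2: the boxes of side \<open>2\<^sup>-\<^sup>k\<close> have volume at least \<open>4\<^sup>-\<^sup>k\<close>, so each of
  the \<open>K\<close> layers contributes at least a fixed amount to the integral.
\<close>

lemma torus_integral_lower_bound:
  fixes f :: "real ^ 'd::finite \<Rightarrow> real"
  assumes "CARD('d) \<le> 2" "\<theta>\<^sub>0 \<in> torus" "0 \<le> C" "0 \<le> \<delta>"
    and f: "\<And>\<theta>. 0 \<le> f \<theta>" "\<And>\<theta> h. (\<And>j. \<bar>(\<theta> - \<theta>\<^sub>0) $ j\<bar> \<le> h) \<Longrightarrow> f \<theta> \<le> C * h\<^sup>2"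
    and F: "continuous_on UNIV F" "\<And>\<theta>. \<delta> \<le> Re (F \<theta>) * (f \<theta> + 1 / 4 ^ K)"
  shows "(1 / (2 * pi)) ^ CARD('d) * (\<delta> / ((4 * C + 1) / 3) * K) \<le> Re (torus_integral F)"
proof -
  let ?B = "\<lambda>k::nat. corner_box \<theta>\<^sub>0 (1 / 2 ^ k)"
  define S :: "real ^ 'd \<Rightarrow> real" where "S \<theta> = (\<Sum>k<K. if \<theta> \<in> ?B k then 4 ^ k else 0)" for \<theta>
  \<comment> \<open>The bound 4/3 C for \<open>f * S\<close> plus the bound 1/3 for
    \<open>S / 4 ^ K\<close>.\<close>
  define D where "D = (4 * C + 1) / 3"
  have "0 < D"
    using assms(3) by (simp add: D_def)
  have fB: "f \<theta> \<le> C / 4 ^ k" if "\<theta> \<in> ?B k" for \<theta> k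
    using f(2)[OF corner_box_dist[OF that]] by (simp add: power2_eq_square flip: power_mult_distrib)
  have S: "S \<theta> * (f \<theta> + 1 / 4 ^ K) \<le> D" for \<theta>
  proof -
    have "S \<theta> \<le> 4 ^ K / 3" "f \<theta> * S \<theta> \<le> 4 / 3 * C"
      unfolding S_def by (rule geometric_layers[of _ C]; use f(1) assms(3) fB in blast)+
    then have "f \<theta> * S \<theta> + S \<theta> * (1 / 4 ^ K) \<le> 4 / 3 * C + 4 ^ K / 3 * (1 / 4 ^ K)"
      by (intro add_mono mult_right_mono) auto
    then show ?thesis
      by (simp add: D_def field_simps)
  qed
  \<comment> \<open>The step function S, up to a factor, is a minorant of the integrand with an
    explicit integral.\<close>
  have le: "\<delta> / D * S \<theta> \<le> Re (F \<theta>)" for \<theta>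
  proof -
    have pos: "0 < f \<theta> + 1 / 4 ^ K"
      using f(1)[of \<theta>] by (intro add_nonneg_pos) auto
    have "\<delta> / D * S \<theta> * (f \<theta> + 1 / 4 ^ K) \<le> \<delta> / D * D"
      unfolding mult.assoc using \<open>0 < D\<close> assms(4) by (intro mult_left_mono S) auto
    also have "\<dots> \<le> Re (F \<theta>) * (f \<theta> + 1 / 4 ^ K)"
      using \<open>0 < D\<close> F(2) by simp
    finally show ?thesis
      using pos by (rule mult_right_le_imp_le)
  qed
  have "((\<lambda>\<theta>. if \<theta> \<in> ?B k then (4::real) ^ k else 0) has_integral 4 ^ k * (1 / 2 ^ k) ^ CARD('d)) torus_box"
    for k
  proof -
    have "((\<lambda>\<theta>. 4 ^ k :: real) has_integral measure lborel (?B k) *\<^sub>R 4 ^ k) (?B k)"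
      unfolding corner_box_def by (rule has_integral_const)
    then show ?thesis
      using corner_box_subset[OF assms(2), of "1 / 2 ^ k"]
      by (simp add: has_integral_restrict measure_corner_box mult.commute)
  qed
  then have intS: "(S has_integral (\<Sum>k<K. 4 ^ k * (1 / 2 ^ k) ^ CARD('d))) torus_box"
    unfolding S_def by (intro has_integral_sum) auto
  \<comment> \<open>Dimension at most 2 enters here: height times volume of each layer is at least
    1.\<close>
  have "1 \<le> 4 ^ k * (1 / 2 ^ k :: real) ^ CARD('d)" for k :: nat
  proof -
    have "(1 / 2 ^ k :: real) ^ 2 \<le> (1 / 2 ^ k) ^ CARD('d)"
      using assms(1) by (intro power_decreasing) auto
    then have "4 ^ k * (1 / 2 ^ k :: real) ^ 2 \<le> 4 ^ k * (1 / 2 ^ k) ^ CARD('d)"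
      by (intro mult_left_mono) auto
    moreover have "4 ^ k * (1 / 2 ^ k :: real) ^ 2 = 1"
      by (simp add: power2_eq_square flip: power_mult_distrib)
    ultimately show ?thesis
      by simp
  qed
  then have K: "real K \<le> (\<Sum>k<K. 4 ^ k * (1 / 2 ^ k :: real) ^ CARD('d))"
    using sum_mono[of "{..<K}" "\<lambda>_. 1 :: real"] by simp
  have "\<delta> / D * K \<le> \<delta> / D * (\<Sum>k<K. 4 ^ k * (1 / 2 ^ k) ^ CARD('d))"
    using \<open>0 < D\<close> assms(4) by (intro mult_left_mono K) auto
  also have "\<dots> \<le> integral torus_box (\<lambda>\<theta>. Re (F \<theta>))"
  proof (rule has_integral_le)
    show "((\<lambda>\<theta>. \<delta> / D * S \<theta>) has_integral \<delta> / D * (\<Sum>k<K. 4 ^ k * (1 / 2 ^ k) ^ CARD('d))) torus_box"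
      by (intro has_integral_mult_right intS)
    show "((\<lambda>\<theta>. Re (F \<theta>)) has_integral integral torus_box (\<lambda>\<theta>. Re (F \<theta>))) torus_box"
      by (intro integrable_integral integrable_torus_box continuous_intros F)
  qed (rule le)
  finally show ?thesis
    unfolding Re_torus_integral[OF F(1)] D_def
    by (intro mult_left_mono) auto
qed

lemma abs_pairing_le:
  assumes "\<And>j. \<bar>x $ j\<bar> \<le> h"
  shows "\<bar>pairing k x\<bar> \<le> (\<Sum>j\<in>UNIV. \<bar>of_int (k $ j)\<bar>) * h"
  unfolding pairing_def sum_distrib_right
  by (rule order_trans[OF sum_abs]) (auto intro!: sum_mono mult_left_mono assms simp: abs_mult)

lemma cos_quadratic_bound: "\<bar>2 * cos t - 2\<bar> \<le> t\<^sup>2" for t :: real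
proof -
  have "2 * cos t - 2 = - (2 * sin (t / 2))\<^sup>2"
    using cos_double_sin[of "t / 2"] by (simp add: power2_eq_square)
  moreover have "(2 * sin (t / 2))\<^sup>2 \<le> t\<^sup>2"
    using abs_sin_x_le_abs_x[of "t / 2"] by (subst abs_le_square_iff[symmetric]) (simp add: abs_mult)
  ultimately show ?thesis
    by simp
qed

text \<open>Adding the value at the reflected point cancels the first-order term at the zero.\<close>

lemma trig_poly_quadratic_bound:
  fixes ix :: "'l::finite \<Rightarrow> int ^ 'd::finite"
  assumes nonneg: "\<And>\<theta>. 0 \<le> Re (trig_poly ix q \<theta>)" and zero: "Re (trig_poly ix q \<theta>\<^sub>0) = 0"
  obtains C where "0 \<le> C"
    "\<And>\<theta> h. (\<And>j. \<bar>(\<theta> - \<theta>\<^sub>0) $ j\<bar> \<le> h) \<Longrightarrow> Re (trig_poly ix q \<theta>) \<le> C * h\<^sup>2"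
proof
  let ?C = "\<Sum>l\<in>UNIV. norm (q $ l) * (\<Sum>j\<in>UNIV. \<bar>real_of_int ((- ix l) $ j)\<bar>)\<^sup>2"
  show "0 \<le> ?C"
    by (intro sum_nonneg) auto
  fix \<theta> :: "real ^ 'd" and h :: real
  define x where "x = \<theta> - \<theta>\<^sub>0"
  assume "\<And>j. \<bar>(\<theta> - \<theta>\<^sub>0) $ j\<bar> \<le> h"
  then have h: "\<bar>x $ j\<bar> \<le> h" for j
    by (simp add: x_def)
  \<comment> \<open>A symmetric second difference only multiplies a character by a factor of second
    order in \<open>x\<close>.\<close>
  have char: "fourier_char k (\<theta>\<^sub>0 + x) + fourier_char k (\<theta>\<^sub>0 - x) - 2 * fourier_char k \<theta>\<^sub>0 =
      fourier_char k \<theta>\<^sub>0 * of_real (2 * cos (pairing k x) - 2)" for k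
  proof -
    have "fourier_char k x + cnj (fourier_char k x) = of_real (2 * Re (fourier_char k x))"
      by (rule complex_add_cnj)
    moreover have "Re (fourier_char k x) = cos (pairing k x)"
      by (simp add: fourier_char_def Re_exp)
    ultimately have *: "fourier_char k x + cnj (fourier_char k x) = of_real (2 * cos (pairing k x))"
      by simp
    have "fourier_char k (\<theta>\<^sub>0 + x) + fourier_char k (\<theta>\<^sub>0 - x) - 2 * fourier_char k \<theta>\<^sub>0 =
        fourier_char k \<theta>\<^sub>0 * (fourier_char k x + cnj (fourier_char k x) - 2)"
      by (simp add: fourier_char_add_right fourier_char_diff_right algebra_simps)
    then show ?thesis
      unfolding * by simp
  qed
  have "Re (trig_poly ix q \<theta>) = Re (trig_poly ix q (\<theta>\<^sub>0 + x))"
    by (simp add: x_def)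
  also have "\<dots> \<le> Re (trig_poly ix q (\<theta>\<^sub>0 + x) + trig_poly ix q (\<theta>\<^sub>0 - x) - 2 * trig_poly ix q \<theta>\<^sub>0)"
    using nonneg[of "\<theta>\<^sub>0 - x"] zero by simp
  also have "trig_poly ix q (\<theta>\<^sub>0 + x) + trig_poly ix q (\<theta>\<^sub>0 - x) - 2 * trig_poly ix q \<theta>\<^sub>0 =
      (\<Sum>l\<in>UNIV. q $ l * (fourier_char (- ix l) (\<theta>\<^sub>0 + x) + fourier_char (- ix l) (\<theta>\<^sub>0 - x)
        - 2 * fourier_char (- ix l) \<theta>\<^sub>0))"
    unfolding trig_poly_eq
    by (simp add: sum_distrib_left algebra_simps flip: sum.distrib sum_subtractf)
  also have "Re \<dots> \<le> norm \<dots>"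
    by (rule complex_Re_le_cmod)
  also have "\<dots> \<le> (\<Sum>l\<in>UNIV. norm (q $ l) * \<bar>2 * cos (pairing (- ix l) x) - 2\<bar>)"
    unfolding char by (rule order_trans[OF norm_sum]) (simp only: norm_mult norm_fourier_char norm_of_real mult_1_left order_refl)
  also have "\<dots> \<le> (\<Sum>l\<in>UNIV. norm (q $ l) * ((\<Sum>j\<in>UNIV. \<bar>real_of_int ((- ix l) $ j)\<bar>)\<^sup>2 * h\<^sup>2))"
  proof (intro sum_mono mult_left_mono norm_ge_zero)
    fix l
    have "(pairing (- ix l) x)\<^sup>2 \<le> ((\<Sum>j\<in>UNIV. \<bar>real_of_int ((- ix l) $ j)\<bar>) * h)\<^sup>2"
      using abs_pairing_le[of x h "- ix l", OF h] by (metis abs_ge_zero power2_abs power_mono)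
    then show "\<bar>2 * cos (pairing (- ix l) x) - 2\<bar> \<le> (\<Sum>j\<in>UNIV. \<bar>real_of_int ((- ix l) $ j)\<bar>)\<^sup>2 * h\<^sup>2"
      using cos_quadratic_bound[of "pairing (- ix l) x"] by (simp only: power_mult_distrib)
  qed
  also have "\<dots> = ?C * h\<^sup>2"
    by (simp only: sum_distrib_right mult.assoc)
  finally show "Re (trig_poly ix q \<theta>) \<le> ?C * h\<^sup>2" .
qed

section \<open>Continuity, coercivity and limits of solutions\<close>

lemma continuous_on_weight_matrix:
  assumes "continuous_on (U \<times> UNIV) (\<lambda>(x, \<theta>). w x \<theta>)"
  shows "continuous_on U (\<lambda>x. weight_matrix ix (w x))"
  unfolding weight_matrix_def
  using assms
  by (intro continuous_on_vec_lambda continuous_on_torus_integral)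
    (auto simp: case_prod_unfold intro!: continuous_intros)

lemma continuous_on_matrix_vector_mult [continuous_intros]:
  fixes A :: "_ \<Rightarrow> complex ^ 'n::finite ^ 'm::finite"
  assumes "continuous_on S A" "continuous_on S f"
  shows "continuous_on S (\<lambda>x. A x *v f x)"
  unfolding matrix_vector_mult_def
  using assms by (intro continuous_on_vec_lambda continuous_intros)

text \<open>By homogeneity it is enough to treat unit vectors of the closed cone. These form a
  compact set on which the pairing with \<open>c\<close> is positive.\<close>

lemma C_plus_coercive:
  assumes "c \<in> C_plus ix"
  obtains \<epsilon> where "0 < \<epsilon>" "\<And>q. q \<in> P_plus ix \<Longrightarrow> \<epsilon> * norm q \<le> Re (coeff_inner c q)"
proof -
  let ?K = "closure (P_plus ix) \<inter> sphere 0 1"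
  have comp: "compact ?K"
    by (intro closed_Int_compact) auto
  have "\<exists>\<epsilon>>0. \<forall>q\<in>?K. \<epsilon> \<le> Re (coeff_inner c q)"
  proof (cases "?K = {}")
    case False
    then have "\<exists>x\<in>?K. \<forall>q\<in>?K. Re (coeff_inner c x) \<le> Re (coeff_inner c q)"
      by (intro continuous_attains_inf comp continuous_intros)
    moreover have "0 < Re (coeff_inner c x)" if "x \<in> ?K" for x
      using that assms by (auto simp: C_plus_def)
    ultimately show ?thesis
      by blast
  qed (use zero_less_one in blast)
  then obtain \<epsilon> where \<epsilon>: "0 < \<epsilon>" "\<And>q. q \<in> ?K \<Longrightarrow> \<epsilon> \<le> Re (coeff_inner c q)"
    by blast
  show ?thesis
  proof (rule that[OF \<epsilon>(1)])
    fix q assume q: "q \<in> P_plus ix"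
    then have "0 < norm q"
      using P_plus_nonzero[OF q, of 0] by (auto simp: trig_poly_def)
    then have "(1 / norm q) *\<^sub>R q \<in> P_plus ix"
      by (intro P_plus_scaleR q) auto
    then have "(1 / norm q) *\<^sub>R q \<in> ?K"
      using \<open>0 < norm q\<close> closure_subset by force
    from \<epsilon>(2)[OF this] show "\<epsilon> * norm q \<le> Re (coeff_inner c q)"
      using \<open>0 < norm q\<close> by (simp add: coeff_inner_scaleR_right field_simps)
  qed
qed

context symmetric_index
begin

lemma continuous_on_resolvent_weight: "continuous_on (P_plus ix) resolvent_weight"
  unfolding resolvent_weight_def
  by (intro continuous_on_weight_matrix)
    (auto simp: case_prod_unfold P_plus_nonzero intro!: continuous_intros)

lemma moment_map_resolvent: "q \<in> P_plus ix \<Longrightarrow> moment_map ix p q = resolvent_weight q *v p"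
  by (simp add: moment_map_eq_weight_matrix resolvent_weight_def)

lemma continuous_on_moment_map: "continuous_on (UNIV \<times> P_plus ix) (\<lambda>(p, q). moment_map ix p q)"
proof -
  have "continuous_on (UNIV \<times> P_plus ix) (\<lambda>x. resolvent_weight (snd x) *v fst x)"
    by (intro continuous_intros continuous_on_compose2[OF continuous_on_resolvent_weight]) auto
  then show ?thesis
    by (rule continuous_on_eq) (auto simp: moment_map_resolvent)
qed

lemma tendsto_moment_map:
  assumes "p \<longlonglongrightarrow> p\<^sub>0" "q \<longlonglongrightarrow> q\<^sub>0" "q\<^sub>0 \<in> P_plus ix" "\<And>n. q n \<in> P_plus ix"
  shows "(\<lambda>n. moment_map ix (p n) (q n)) \<longlonglongrightarrow> moment_map ix p\<^sub>0 q\<^sub>0"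
  using continuous_on_tendsto_compose[OF continuous_on_moment_map tendsto_Pair[OF assms(1,2)]] assms
  by simp

text \<open>Pairing the moments with \<open>q n\<close> cancels the denominator and leaves the
  integral of P, which is bounded. Coercivity of \<open>c\<close> turns this into a bound on
  \<open>q n\<close>.\<close>

lemma moment_map_proper_bounded:
  assumes p: "\<And>n. p n \<in> P_plus ix" and q: "\<And>n. q n \<in> P_plus ix" and "Bseq p"
    and lim: "(\<lambda>n. moment_map ix (p n) (q n)) \<longlonglongrightarrow> c" and c: "c \<in> C_plus ix"
  shows "Bseq q"
proof -
  obtain \<epsilon> where \<epsilon>: "0 < \<epsilon>" "\<And>q. q \<in> P_plus ix \<Longrightarrow> \<epsilon> * norm q \<le> Re (coeff_inner c q)"
    using C_plus_coercive[OF c] by metis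
  obtain B where B: "\<And>n. norm (p n) \<le> B"
    using \<open>Bseq p\<close> by (auto simp: Bseq_def)
  let ?m = "\<lambda>n. moment_map ix (p n) (q n)"
  have "(\<lambda>n. CARD('l) * norm (?m n - c)) \<longlonglongrightarrow> CARD('l) * norm (c - c)"
    by (intro tendsto_intros lim)
  \<comment> \<open>Half of the coercivity constant pays for replacing \<open>c\<close> by the
    nearby moments.\<close>
  then have "\<forall>\<^sub>F n in sequentially. CARD('l) * norm (?m n - c) < \<epsilon> / 2"
    by (rule order_tendstoD) (use \<epsilon> in simp)
  then have "\<forall>\<^sub>F n in sequentially. norm (q n) \<le> CARD('l) * B / (\<epsilon> / 2)"
  proof eventually_elim
    case (elim n)
    have "Re (coeff_inner (?m n) (q n)) = Re (torus_integral (trig_poly ix (p n)))"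
      unfolding coeff_inner_moment_map[OF q]
      using P_plus_subset_herm_space[THEN subsetD, OF q, of n] P_plus_nonzero[OF q, of n]
      by (simp add: cnj_trig_poly)
    also have "\<dots> \<le> CARD('l) * norm (p n)"
      by (intro order_trans[OF complex_Re_le_cmod] norm_torus_integral_le norm_trig_poly_le continuous_intros)
    also have "\<dots> \<le> CARD('l) * B"
      by (intro mult_left_mono B) auto
    finally have 1: "Re (coeff_inner (?m n) (q n)) \<le> CARD('l) * B" .
    have "- Re (coeff_inner (?m n - c) (q n)) \<le> norm (coeff_inner (?m n - c) (q n))"
      by (metis abs_Re_le_cmod abs_le_D2)
    also have "\<dots> \<le> CARD('l) * norm (?m n - c) * norm (q n)"
      unfolding mult.assoc by (rule norm_coeff_inner_le)
    also have "\<dots> \<le> \<epsilon> / 2 * norm (q n)"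
      using elim by (intro mult_right_mono) auto
    finally have 2: "- Re (coeff_inner (?m n - c) (q n)) \<le> \<epsilon> / 2 * norm (q n)" .
    have "norm (q n) * (\<epsilon> / 2) \<le> CARD('l) * B"
      using 1 2 \<epsilon>(2)[OF q, of n] by (simp add: coeff_inner_diff_left algebra_simps)
    then show ?case
      using \<epsilon>(1) by (subst pos_le_divide_eq) auto
  qed
  then show ?thesis
    by (rule BfunI)
qed

text \<open>If the limit polynomial had a zero, the zeroth moments of P / Q would exceed any bound
  along the sequence, although they converge to a component of \<open>c\<close>.\<close>

lemma moment_map_proper_interior:
  assumes d: "CARD('d) \<le> 2"
    and p: "\<And>n. p n \<in> P_plus ix" "p \<longlonglongrightarrow> p\<^sub>0" "p\<^sub>0 \<in> P_plus ix"
    and q: "\<And>n. q n \<in> P_plus ix" "q \<longlonglongrightarrow> q\<^sub>0"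
    and lim: "(\<lambda>n. moment_map ix (p n) (q n)) \<longlonglongrightarrow> c"
  shows "q\<^sub>0 \<in> P_plus ix"
proof (rule ccontr)
  assume not: "q\<^sub>0 \<notin> P_plus ix"
  have cl: "q\<^sub>0 \<in> closure (P_plus ix)"
    using q by (auto simp: closure_sequential)
  note q\<^sub>0 = closure_P_plus[OF cl]
  obtain \<theta>\<^sub>0 where \<theta>\<^sub>0: "\<theta>\<^sub>0 \<in> torus" "Re (trig_poly ix q\<^sub>0 \<theta>\<^sub>0) = 0"
    using not q\<^sub>0 by (auto simp: P_plus_def not_less intro: antisym)
  obtain C where C: "0 \<le> C"
    "\<And>\<theta> h. (\<And>j. \<bar>(\<theta> - \<theta>\<^sub>0) $ j\<bar> \<le> h) \<Longrightarrow> Re (trig_poly ix q\<^sub>0 \<theta>) \<le> C * h\<^sup>2"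
    using trig_poly_quadratic_bound[OF q\<^sub>0(2) \<theta>\<^sub>0(2)] by blast
  obtain \<delta> where \<delta>: "0 < \<delta>" "\<And>\<theta>. \<delta> \<le> Re (trig_poly ix p\<^sub>0 \<theta>)"
    using P_plus_lower_bound[OF p(3)] by metis
  obtain z where z: "ix z = 0"
    using ex_zero_ix by blast
  define b where "b = (1 / (2 * pi)) ^ CARD('d) * (\<delta> / 2 / ((4 * C + 1) / 3))"
  have "0 < b"
    using \<delta>(1) C(1) by (simp add: b_def)
  \<comment> \<open>The number of layers is fixed before \<open>n\<close>, so that the lower bound
    on the integral beats the limiting zeroth moment with room to spare.\<close>
  then obtain K :: nat where K: "Re (c $ z) + 1 < b * K"
    using reals_Archimedean3[of b] by (auto simp: mult.commute)
  have "(\<lambda>n. Re (moment_map ix (p n) (q n) $ z)) \<longlonglongrightarrow> Re (c $ z)"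
    by (intro tendsto_intros lim)
  then have "\<forall>\<^sub>F n in sequentially. Re (moment_map ix (p n) (q n) $ z) < Re (c $ z) + 1"
    by (rule order_tendstoD) simp
  moreover have "(\<lambda>n. CARD('l) * norm (p n - p\<^sub>0)) \<longlonglongrightarrow> CARD('l) * norm (p\<^sub>0 - p\<^sub>0)"
    by (intro tendsto_intros p)
  then have "\<forall>\<^sub>F n in sequentially. CARD('l) * norm (p n - p\<^sub>0) < \<delta> / 2"
    by (rule order_tendstoD) (use \<delta> in simp)
  moreover have "(\<lambda>n. CARD('l) * norm (q n - q\<^sub>0)) \<longlonglongrightarrow> CARD('l) * norm (q\<^sub>0 - q\<^sub>0)"
    by (intro tendsto_intros q)
  \<comment> \<open>This tolerance is the regularising term that
    \<open>torus_integral_lower_bound\<close> adds to the limit polynomial.\<close>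
  then have "\<forall>\<^sub>F n in sequentially. CARD('l) * norm (q n - q\<^sub>0) < 1 / 4 ^ K"
    by (rule order_tendstoD) simp
  ultimately have "\<forall>\<^sub>F n in sequentially. False"
  proof eventually_elim
    case (elim n)
    let ?P = "trig_poly ix (p n)" and ?Q = "trig_poly ix (q n)"
    let ?F = "\<lambda>\<theta>. ?P \<theta> / ?Q \<theta>"
    have herm: "p n \<in> herm_space ix" "q n \<in> herm_space ix"
      using p(1) q(1) P_plus_subset_herm_space by auto
    have "\<delta> / 2 \<le> Re (?F \<theta>) * (Re (trig_poly ix q\<^sub>0 \<theta>) + 1 / 4 ^ K)" for \<theta>
    proof -
      have "Re (trig_poly ix (p\<^sub>0 - p n) \<theta>) \<le> CARD('l) * norm (p\<^sub>0 - p n)"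
        by (rule order_trans[OF complex_Re_le_cmod norm_trig_poly_le])
      then have P: "\<delta> / 2 \<le> Re (?P \<theta>)"
        using elim(2) \<delta>(2)[of \<theta>] by (simp add: trig_poly_diff norm_minus_commute)
      have "Re (trig_poly ix (q n - q\<^sub>0) \<theta>) \<le> CARD('l) * norm (q n - q\<^sub>0)"
        by (rule order_trans[OF complex_Re_le_cmod norm_trig_poly_le])
      then have Q: "Re (?Q \<theta>) \<le> Re (trig_poly ix q\<^sub>0 \<theta>) + 1 / 4 ^ K"
        using elim(3) by (simp add: trig_poly_diff)
      have F: "Re (?F \<theta>) = Re (?P \<theta>) / Re (?Q \<theta>)"
        by (subst (1 2) trig_poly_of_real) (use herm in simp_all)
      have "Re (?P \<theta>) = Re (?F \<theta>) * Re (?Q \<theta>)"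
        unfolding F using P_plus_pos[OF q(1), of n \<theta>] by simp
      also have "\<dots> \<le> Re (?F \<theta>) * (Re (trig_poly ix q\<^sub>0 \<theta>) + 1 / 4 ^ K)"
        unfolding F using P_plus_pos[OF q(1), of n \<theta>] P_plus_pos[OF p(1), of n \<theta>]
        by (intro mult_left_mono Q) auto
      finally show ?thesis
        using P by linarith
    qed
    moreover have "continuous_on UNIV ?F"
      unfolding divide_inverse by (intro continuous_intros q(1))
    ultimately have "(1 / (2 * pi)) ^ CARD('d) * (\<delta> / 2 / ((4 * C + 1) / 3) * K) \<le> Re (torus_integral ?F)"
      using \<delta>(1) by (intro torus_integral_lower_bound[OF d \<theta>\<^sub>0(1) C(1) _ q\<^sub>0(2) C(2)]) auto
    then have "b * K \<le> Re (torus_integral ?F)"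
      by (simp only: b_def mult.assoc)
    then show False
      using elim(1) K by (simp add: moment_map_eq_moments z)
  qed
  then show False
    by simp
qed

text \<open>Both \<open>p\<close> and the moments may vary: a constant \<open>p\<close> gives
  closedness of the image, constant moments give continuity of \<open>g_map\<close>.\<close>

lemma moment_map_proper:
  assumes d: "CARD('d) \<le> 2"
    and p: "\<And>n. p n \<in> P_plus ix" "p \<longlonglongrightarrow> p\<^sub>0" "p\<^sub>0 \<in> P_plus ix"
    and q: "\<And>n. q n \<in> P_plus ix"
    and lim: "(\<lambda>n. moment_map ix (p n) (q n)) \<longlonglongrightarrow> c" and c: "c \<in> C_plus ix"
  obtains r q\<^sub>0 where "strict_mono r" "q\<^sub>0 \<in> P_plus ix" "(q \<circ> r) \<longlonglongrightarrow> q\<^sub>0" "moment_map ix p\<^sub>0 q\<^sub>0 = c"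
proof -
  have "Bseq q"
    using convergent_imp_Bseq[OF convergentI[OF p(2)]] moment_map_proper_bounded[OF p(1) q _ lim c]
    by blast
  then have "bounded (range q)"
    by (simp add: Bseq_eq_bounded)
  then obtain r q\<^sub>0 where r: "strict_mono r" "(q \<circ> r) \<longlonglongrightarrow> q\<^sub>0"
    using bounded_imp_convergent_subsequence by metis
  have "(p \<circ> r) \<longlonglongrightarrow> p\<^sub>0" and lim': "(\<lambda>n. moment_map ix ((p \<circ> r) n) ((q \<circ> r) n)) \<longlonglongrightarrow> c"
    using LIMSEQ_subseq_LIMSEQ[OF p(2) r(1)] LIMSEQ_subseq_LIMSEQ[OF lim r(1)] by (simp_all add: o_def)
  have q\<^sub>0: "q\<^sub>0 \<in> P_plus ix"
    using moment_map_proper_interior[OF d _ \<open>(p \<circ> r) \<longlonglongrightarrow> p\<^sub>0\<close> p(3) _ r(2) lim'] p(1) q by simp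
  have "moment_map ix p\<^sub>0 q\<^sub>0 = c"
    using tendsto_moment_map[OF \<open>(p \<circ> r) \<longlonglongrightarrow> p\<^sub>0\<close> r(2) q\<^sub>0] lim' q LIMSEQ_unique by auto
  then show ?thesis
    using that r q\<^sub>0 by blast
qed

end

section \<open>Bijectivity of the moment map\<close>

context symmetric_index
begin

text \<open>Invariance of domain with \<open>herm_space ix\<close> as source and target, so that the
  dimensions agree.\<close>

lemma openin_injective_image:
  assumes "continuous_on (P_plus ix) f" "f ` P_plus ix \<subseteq> herm_space ix" "inj_on f (P_plus ix)"
  shows "openin (top_of_set (herm_space ix)) (f ` P_plus ix)"
  using assms
  by (intro invariance_of_domain_subspaces[OF openin_P_plus subspace_herm_space subspace_herm_space]) auto

text \<open>The image is nonempty, open and closed in a connected set.\<close>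

lemma moment_map_image:
  assumes d: "CARD('d) \<le> 2" and p: "p \<in> P_plus ix"
  shows "moment_map ix p ` P_plus ix = C_plus ix"
proof -
  let ?S = "moment_map ix p ` P_plus ix"
  have sub: "?S \<subseteq> C_plus ix"
    using moment_map_in_C_plus[OF p] by blast
  have "continuous_on (P_plus ix) (\<lambda>q. resolvent_weight q *v p)"
    by (intro continuous_intros continuous_on_resolvent_weight)
  then have "continuous_on (P_plus ix) (moment_map ix p)"
    by (rule continuous_on_eq) (simp add: moment_map_resolvent)
  then have "openin (top_of_set (herm_space ix)) ?S"
    using sub C_plus_subset_herm_space by (intro openin_injective_image inj_on_moment_map p) auto
  then have "openin (top_of_set (C_plus ix)) ?S"
    using sub C_plus_subset_herm_space by (rule openin_subset_trans)
  moreover have "closedin (top_of_set (C_plus ix)) ?S"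
    unfolding closedin_closed
  proof (intro exI[of _ "closure ?S"] conjI closed_closure equalityI subsetI)
    fix c assume c: "c \<in> C_plus ix \<inter> closure ?S"
    then obtain m where m: "\<And>n. m n \<in> ?S" "m \<longlonglongrightarrow> c"
      by (auto simp: closure_sequential)
    then have "\<exists>q. \<forall>n. q n \<in> P_plus ix \<and> m n = moment_map ix p (q n)"
      by (intro choice) auto
    then obtain q where q: "\<And>n. q n \<in> P_plus ix" "\<And>n. m n = moment_map ix p (q n)"
      by blast
    then have "(\<lambda>n. moment_map ix p (q n)) \<longlonglongrightarrow> c"
      using m(2) by (simp flip: q(2))
    then obtain q\<^sub>0 where "q\<^sub>0 \<in> P_plus ix" "moment_map ix p q\<^sub>0 = c"
      using moment_map_proper[OF d p tendsto_const p q(1), of "\<lambda>n. n" c] c by blast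
    then show "c \<in> ?S"
      by blast
  next
    fix m assume "m \<in> ?S"
    then show "m \<in> C_plus ix \<inter> closure ?S"
      by (intro IntI subsetD[OF sub] subsetD[OF closure_subset])
  qed
  moreover have "connected (C_plus ix)"
    by (rule convex_connected[OF convex_C_plus])
  moreover have "?S \<noteq> {}"
    using P_plus_nonempty by simp
  ultimately show ?thesis
    unfolding connected_clopen by blast
qed

lemma bij_betw_moment_map:
  assumes "CARD('d) \<le> 2" "p \<in> P_plus ix"
  shows "bij_betw (moment_map ix p) (P_plus ix) (C_plus ix)"
  using moment_map_image[OF assms] inj_on_moment_map[OF assms(2)] by (simp add: bij_betw_def)

section \<open>The solution map for fixed moments\<close>

lemma g_map_in_P_plus:
  assumes "CARD('d) \<le> 2" "c \<in> C_plus ix" "p \<in> P_plus ix"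
  shows "g_map ix c p \<in> P_plus ix"
  unfolding g_map_def
  using assms by (intro the_inv_into_into inj_on_moment_map) (auto simp: moment_map_image)

lemma moment_map_g_map:
  assumes "CARD('d) \<le> 2" "c \<in> C_plus ix" "p \<in> P_plus ix"
  shows "moment_map ix p (g_map ix c p) = c"
  unfolding g_map_def
  using assms by (intro f_the_inv_into_f inj_on_moment_map) (auto simp: moment_map_image)

lemma g_map_eqI:
  assumes "p \<in> P_plus ix" "q \<in> P_plus ix" "moment_map ix p q = c"
  shows "g_map ix c p = q"
  unfolding g_map_def
  using the_inv_into_f_f[OF inj_on_moment_map[OF assms(1)] assms(2)] assms(3) by simp

lemma inj_on_g_map:
  assumes "CARD('d) \<le> 2" "c \<in> C_plus ix"
  shows "inj_on (g_map ix c) (P_plus ix)"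
  by (rule inj_onI) (metis assms g_map_in_P_plus moment_map_g_map moment_map_inj_left)

text \<open>If the values stayed away from \<open>g_map ix c p\<close> along a subsequence,
  properness would give a further subsequence converging to a solution at \<open>p\<close>; by
  uniqueness that limit is \<open>g_map ix c p\<close>.\<close>

lemma continuous_on_g_map:
  assumes d: "CARD('d) \<le> 2" and c: "c \<in> C_plus ix"
  shows "continuous_on (P_plus ix) (g_map ix c)"
  unfolding continuous_on_sequentially
proof safe
  fix x p
  assume p: "p \<in> P_plus ix" and x: "\<forall>n. x n \<in> P_plus ix" "x \<longlonglongrightarrow> p"
  let ?g = "g_map ix c"
  show "(?g \<circ> x) \<longlonglongrightarrow> ?g p"
  proof (rule tendstoI, rule ccontr)
    fix e :: real assume e: "0 < e" "\<not> (\<forall>\<^sub>F n in sequentially. dist ((?g \<circ> x) n) (?g p) < e)"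
    then have "infinite {n. e \<le> dist (?g (x n)) (?g p)}"
      by (auto simp: frequently_cofinite[symmetric] cofinite_eq_sequentially not_eventually not_less)
    then obtain s :: "nat \<Rightarrow> nat" where s: "strict_mono s" "\<And>n. e \<le> dist (?g (x (s n))) (?g p)"
      using infinite_enumerate by blast
    have "(x \<circ> s) \<longlonglongrightarrow> p"
      by (rule LIMSEQ_subseq_LIMSEQ[OF x(2) s(1)])
    moreover have "moment_map ix ((x \<circ> s) n) (?g ((x \<circ> s) n)) = c" for n
      using x(1) by (simp add: moment_map_g_map[OF d c])
    then have "(\<lambda>n. moment_map ix ((x \<circ> s) n) (?g ((x \<circ> s) n))) \<longlonglongrightarrow> c"
      by simp
    moreover have "(x \<circ> s) n \<in> P_plus ix" "?g ((x \<circ> s) n) \<in> P_plus ix" for n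
      using x(1) g_map_in_P_plus[OF d c] by simp_all
    ultimately obtain r q\<^sub>0 where
      r: "q\<^sub>0 \<in> P_plus ix" "((\<lambda>n. ?g ((x \<circ> s) n)) \<circ> r) \<longlonglongrightarrow> q\<^sub>0" "moment_map ix p q\<^sub>0 = c"
      using moment_map_proper[OF d _ _ p _ _ c, of "x \<circ> s" "\<lambda>n. ?g ((x \<circ> s) n)"] by metis
    then have "(\<lambda>n. ?g (x (s (r n)))) \<longlonglongrightarrow> ?g p"
      using g_map_eqI[OF p] by (simp add: o_def)
    then have "\<forall>\<^sub>F n in sequentially. dist (?g (x (s (r n)))) (?g p) < e"
      using e(1) by (rule tendstoD)
    then show False
      using s(2) by (auto simp: eventually_sequentially not_less[symmetric])
  qed
qed

lemma openin_Q_plus: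
  assumes "CARD('d) \<le> 2" "c \<in> C_plus ix"
  shows "openin (top_of_set (herm_space ix)) (Q_plus ix c)"
  unfolding Q_plus_def using P_plus_subset_herm_space
  by (intro openin_injective_image continuous_on_g_map inj_on_g_map assms)
    (use g_map_in_P_plus[OF assms] in blast)

end

section \<open>Smoothness of solution families\<close>

text \<open>Smoothness without formulas for higher derivatives: induction on the order needs only a
  class stable under directional derivatives.\<close>

lemma Ck_on_closed_class:
  assumes "\<And>f. f \<in> F \<Longrightarrow> \<exists>f'. (\<forall>x\<in>U. (f has_derivative f' x) (at x within U)) \<and> (\<forall>v\<in>V. (\<lambda>x. f' x v) \<in> F)"
    and "f \<in> F"
  shows "Ck_on n V U f"
  using assms(2)
proof (induction n arbitrary: f)
  case 0
  then show ?case
    using assms(1)[OF 0] has_derivative_continuous_on by fastforce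
next
  case (Suc n)
  then show ?case
    using assms(1)[OF Suc.prems] by auto
qed

lemma has_derivative_vecI:
  fixes f :: "'a::euclidean_space \<Rightarrow> 'b::euclidean_space ^ 'n::finite"
  assumes "\<And>i. ((\<lambda>x. f x $ i) has_derivative (\<lambda>v. f' v $ i)) (at x within S)"
  shows "(f has_derivative f') (at x within S)"
  by (subst has_derivative_componentwise_within)
    (auto simp: Basis_vec_def inner_axis intro!: has_derivative_inner_left assms)

lemma Ck_on_vec:
  fixes f :: "'a::euclidean_space \<Rightarrow> 'b::euclidean_space ^ 'n::finite"
  assumes "\<And>i. Ck_on n V U (\<lambda>x. f x $ i)"
  shows "Ck_on n V U f"
  using assms
proof (induction n arbitrary: f)
  case 0
  then have "continuous_on U (\<lambda>x. \<chi> i. f x $ i)"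
    by (intro continuous_on_vec_lambda) simp
  then show ?case
    by simp
next
  case (Suc n)
  have "\<exists>f'. \<forall>i. (\<forall>x\<in>U. ((\<lambda>x. f x $ i) has_derivative f' i x) (at x within U)) \<and>
      (\<forall>v\<in>V. Ck_on n V U (\<lambda>x. f' i x v))"
    using Suc.prems by (intro choice) simp
  then obtain f' where f':
    "\<And>i x. x \<in> U \<Longrightarrow> ((\<lambda>x. f x $ i) has_derivative f' i x) (at x within U)"
    "\<And>i v. v \<in> V \<Longrightarrow> Ck_on n V U (\<lambda>x. f' i x v)"
    by blast
  show ?case
    unfolding Ck_on.simps
  proof (intro exI[of _ "\<lambda>x v. \<chi> i. f' i x v"] conjI ballI)
    show "(f has_derivative (\<lambda>v. \<chi> i. f' i x v)) (at x within U)" if "x \<in> U" for x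
      by (rule has_derivative_vecI) (simp add: f'(1)[OF that])
    show "Ck_on n V U (\<lambda>x. \<chi> i. f' i x v)" if "v \<in> V" for v
      by (rule Suc.IH) (simp add: f'(2)[OF that])
  qed
qed

text \<open>Caratheodory's criterion: an exact factorisation of the increment with continuous
  coefficients gives the derivative, read off at the base point.\<close>

lemma has_derivative_caratheodory:
  fixes f :: "complex ^ 'l::finite \<Rightarrow> complex"
  assumes "\<And>y. y \<in> U \<Longrightarrow> f y - f x = (\<Sum>l\<in>UNIV. (y - x) $ l * \<psi> l y)"
    and \<psi>: "\<And>l. continuous_on U (\<psi> l)" and "x \<in> U"
  shows "(f has_derivative (\<lambda>v. \<Sum>l\<in>UNIV. v $ l * \<psi> l x)) (at x within U)"
proof (rule has_derivativeI_sandwich[of 1])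
  show "bounded_linear (\<lambda>v::complex ^ 'l. \<Sum>l\<in>UNIV. v $ l * \<psi> l x)"
    by (intro bounded_linear_sum bounded_linear_mult_const bounded_linear_vec_nth)
  let ?H = "\<lambda>y. \<Sum>l\<in>UNIV. norm (\<psi> l y - \<psi> l x)"
  show "norm (f y - f x - (\<Sum>l\<in>UNIV. (y - x) $ l * \<psi> l x)) / norm (y - x) \<le> ?H y"
    if "y \<in> U" "y \<noteq> x" for y
  proof -
    have "f y - f x - (\<Sum>l\<in>UNIV. (y - x) $ l * \<psi> l x) = (\<Sum>l\<in>UNIV. (y - x) $ l * (\<psi> l y - \<psi> l x))"
      using assms(1)[OF that(1)] by (simp add: right_diff_distrib sum_subtractf)
    also have "norm \<dots> \<le> (\<Sum>l\<in>UNIV. norm (y - x) * norm (\<psi> l y - \<psi> l x))"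
      by (intro order_trans[OF norm_sum] sum_mono)
        (simp only: norm_mult mult_right_mono Finite_Cartesian_Product.norm_nth_le norm_ge_zero)
    finally show ?thesis
      using that(2) by (simp add: pos_divide_le_eq sum_distrib_left mult.commute)
  qed
  have "(?H \<longlongrightarrow> (\<Sum>l\<in>UNIV. norm (\<psi> l x - \<psi> l x))) (at x within U)"
    using \<psi> \<open>x \<in> U\<close> by (intro tendsto_intros) (auto simp: continuous_on_def)
  then show "(?H \<longlongrightarrow> 0) (at x within U)"
    by simp
qed simp

text \<open>The form that the increment identity takes once it is solved for one of the two
  increments.\<close>

lemma has_derivative_caratheodory_matrix:
  fixes q :: "complex ^ 'l \<Rightarrow> complex ^ 'm::finite"
  assumes "\<And>y. y \<in> U \<Longrightarrow> q y - q x = M y *v (y - x)"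
    and M: "continuous_on U M" and "x \<in> U"
  shows "(q has_derivative (\<lambda>v. M x *v v)) (at x within U)"
proof (rule has_derivative_vecI)
  fix i
  have "((\<lambda>x. q x $ i) has_derivative (\<lambda>v. \<Sum>l\<in>UNIV. v $ l * M x $ i $ l)) (at x within U)"
  proof (rule has_derivative_caratheodory[OF _ _ \<open>x \<in> U\<close>])
    show "q y $ i - q x $ i = (\<Sum>l\<in>UNIV. (y - x) $ l * M y $ i $ l)" if "y \<in> U" for y
      using arg_cong[OF assms(1)[OF that], of "\<lambda>u. u $ i"]
      by (simp add: matrix_vector_mult_def mult.commute)
  qed (intro continuous_intros M)
  then show "((\<lambda>x. q x $ i) has_derivative (\<lambda>v. (M x *v v) $ i)) (at x within U)"
    by (simp add: matrix_vector_mult_def mult.commute)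
qed

text \<open>The inverse by Cramer's rule, whose entries are visibly rational in those of
  \<open>A\<close>; continuity and membership in \<open>moment_fun\<close> can then be read
  off.\<close>

definition cramer_inverse :: "complex ^ 'n ^ 'n \<Rightarrow> complex ^ 'n ^ 'n::finite" where
  "cramer_inverse A = (\<chi> i j. det (\<chi> a b. if b = i then axis j 1 $ a else A $ a $ b) / det A)"

lemma cramer_inverse_mult:
  assumes "det A \<noteq> 0"
  shows "cramer_inverse A ** A = mat 1"
proof -
  \<comment> \<open>Column \<open>j\<close> solves the system with the \<open>j\<close>-th unit
    vector on the right.\<close>
  have "A *v (\<chi> i. cramer_inverse A $ i $ j) = axis j 1" for j
    unfolding cramer[OF assms] by (simp add: cramer_inverse_def)
  then have "A ** cramer_inverse A = mat 1"
    by (auto simp: vec_eq_iff matrix_matrix_mult_def matrix_vector_mult_def mat_def axis_def)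
  then show ?thesis
    by (rule matrix_left_right_inverse1)
qed

lemma cramer_inverse_solve:
  assumes "det A \<noteq> 0" "A *v x = b"
  shows "x = cramer_inverse A *v b"
  using assms by (metis cramer_inverse_mult matrix_vector_mul_assoc matrix_vector_mul_lid)

lemma continuous_on_det [continuous_intros]:
  fixes A :: "_ \<Rightarrow> complex ^ 'n::finite ^ 'n"
  shows "continuous_on S A \<Longrightarrow> continuous_on S (\<lambda>x. det (A x))"
  unfolding det_def by (intro continuous_intros)

lemma continuous_on_cramer_inverse:
  assumes A: "continuous_on S A" and nz: "\<And>x. x \<in> S \<Longrightarrow> det (A x) \<noteq> 0"
  shows "continuous_on S (\<lambda>x. cramer_inverse (A x))"
proof -
  have "continuous_on S (\<lambda>x. if b = i then axis j 1 $ a else A x $ a $ b)" for a b i and j :: 'b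
    by (cases "b = i") (auto intro!: continuous_intros A)
  then show ?thesis
    unfolding cramer_inverse_def by (intro continuous_intros A) (auto simp: nz)
qed

lemma continuous_on_matrix_mult [continuous_intros]:
  fixes A :: "_ \<Rightarrow> complex ^ 'n::finite ^ 'm::finite" and B :: "_ \<Rightarrow> complex ^ 'k::finite ^ 'n"
  assumes "continuous_on S A" "continuous_on S B"
  shows "continuous_on S (\<lambda>x. A x ** B x)"
  unfolding matrix_matrix_mult_def using assms by (intro continuous_intros)

text \<open>
  Along a family \<open>x \<mapsto> (p x, q x)\<close> with \<open>moment_map ix (p x) (q x)\<close> constant, this class contains
  the components of \<open>p\<close> and \<open>q\<close> and is closed under directional derivatives, which yields
  smoothness of all orders at once.
\<close>

inductive moment_fun ::
  "('l::finite \<Rightarrow> int ^ 'd::finite) \<Rightarrow> 'a set \<Rightarrow> ('a \<Rightarrow> complex ^ 'l) \<Rightarrow> ('a \<Rightarrow> complex ^ 'l)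
    \<Rightarrow> ('a \<Rightarrow> complex) \<Rightarrow> bool"
  for ix U p q where
  const: "moment_fun ix U p q (\<lambda>x. a)"
| coeff_p: "moment_fun ix U p q (\<lambda>x. p x $ l)"
| coeff_q: "moment_fun ix U p q (\<lambda>x. q x $ l)"
| moment: "moment_fun ix U p q
    (\<lambda>x. torus_integral (\<lambda>\<theta>. fourier_char k \<theta> * inverse (trig_poly ix (q x) \<theta>) ^ m))"
| add: "moment_fun ix U p q f \<Longrightarrow> moment_fun ix U p q g \<Longrightarrow> moment_fun ix U p q (\<lambda>x. f x + g x)"
| mult: "moment_fun ix U p q f \<Longrightarrow> moment_fun ix U p q g \<Longrightarrow> moment_fun ix U p q (\<lambda>x. f x * g x)"
| inverse: "moment_fun ix U p q f \<Longrightarrow> (\<And>x. x \<in> U \<Longrightarrow> f x \<noteq> 0) \<Longrightarrow>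
    moment_fun ix U p q (\<lambda>x. inverse (f x))"

lemma moment_fun_sum:
  "(\<And>i. i \<in> S \<Longrightarrow> moment_fun ix U p q (f i)) \<Longrightarrow> moment_fun ix U p q (\<lambda>x. \<Sum>i\<in>S. f i x)"
  by (induction S rule: infinite_finite_induct) (auto intro: moment_fun.intros)

lemma moment_fun_prod:
  "(\<And>i. i \<in> S \<Longrightarrow> moment_fun ix U p q (f i)) \<Longrightarrow> moment_fun ix U p q (\<lambda>x. \<Prod>i\<in>S. f i x)"
  by (induction S rule: infinite_finite_induct) (auto intro: moment_fun.intros)

lemma moment_fun_det:
  "(\<And>i j. moment_fun ix U p q (\<lambda>x. A x $ i $ j)) \<Longrightarrow> moment_fun ix U p q (\<lambda>x. det (A x))"
  unfolding det_def by (intro moment_fun_sum moment_fun_prod moment_fun.mult moment_fun.const)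

lemma moment_fun_cramer_inverse:
  assumes A: "\<And>i j. moment_fun ix U p q (\<lambda>x. A x $ i $ j)" and nz: "\<And>x. x \<in> U \<Longrightarrow> det (A x) \<noteq> 0"
  shows "moment_fun ix U p q (\<lambda>x. cramer_inverse (A x) $ i $ j)"
proof -
  have "moment_fun ix U p q (\<lambda>x. if b = i then axis j 1 $ a else A x $ a $ b)" for a b
    by (cases "b = i") (auto intro: A moment_fun.const)
  then show ?thesis
    unfolding cramer_inverse_def divide_inverse vec_lambda_beta
    by (intro moment_fun.mult moment_fun.inverse moment_fun_det A nz) auto
qed

lemma moment_fun_matrix_mult:
  assumes "\<And>i j. moment_fun ix U p q (\<lambda>x. A x $ i $ j)" "\<And>i j. moment_fun ix U p q (\<lambda>x. B x $ i $ j)"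
  shows "moment_fun ix U p q (\<lambda>x. (A x ** B x) $ i $ j)"
  unfolding matrix_matrix_mult_def vec_lambda_beta by (intro moment_fun_sum moment_fun.mult assms)

lemma moment_fun_matrix_vector_mult:
  assumes "\<And>i j. moment_fun ix U p q (\<lambda>x. A x $ i $ j)"
  shows "moment_fun ix U p q (\<lambda>x. (A x *v v) $ i)"
  unfolding matrix_vector_mult_def vec_lambda_beta
  by (intro moment_fun_sum moment_fun.mult moment_fun.const assms)

text \<open>Differentiation shifts the exponent \<open>k\<close> by \<open>- ix l\<close> and raises
  the power of 1 / Q by one. Hence \<open>moment_fun\<close> admits all exponents and all
  powers.\<close>

lemma has_derivative_moment:
  fixes ix :: "'l::finite \<Rightarrow> int ^ 'd::finite"
  assumes q: "q \<in> P_plus ix"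
  shows "((\<lambda>q. torus_integral (\<lambda>\<theta>. fourier_char k \<theta> * inverse (trig_poly ix q \<theta>) ^ m)) has_derivative
    (\<lambda>v. \<Sum>l\<in>UNIV. v $ l * (- of_nat m *
      torus_integral (\<lambda>\<theta>. fourier_char (k - ix l) \<theta> * inverse (trig_poly ix q \<theta>) ^ Suc m))))
    (at q within P_plus ix)"
proof -
  let ?u = "\<lambda>q \<theta>. inverse (trig_poly ix q \<theta>)"
  \<comment> \<open>From the factorisation of a difference of \<open>m\<close>-th powers; its linear
    factor 1/Y - 1/Q equals -(Y - Q) / (Y Q), where Y belongs to \<open>y\<close>.\<close>
  let ?G = "\<lambda>y \<theta>. ?u y \<theta> * ?u q \<theta> * (\<Sum>i<m. ?u q \<theta> ^ (m - Suc i) * ?u y \<theta> ^ i)"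
  let ?\<psi> = "\<lambda>l y. - torus_integral (\<lambda>\<theta>. fourier_char (k - ix l) \<theta> * ?G y \<theta>)"
  have cont: "continuous_on UNIV (\<lambda>\<theta>. fourier_char k \<theta> * ?u y \<theta> ^ m)"
    "continuous_on UNIV (\<lambda>\<theta>. fourier_char k \<theta> * ?G y \<theta>)" if "y \<in> P_plus ix" for y k
    by (intro continuous_intros that q)+
  have "((\<lambda>q. torus_integral (\<lambda>\<theta>. fourier_char k \<theta> * ?u q \<theta> ^ m)) has_derivative
      (\<lambda>v. \<Sum>l\<in>UNIV. v $ l * ?\<psi> l q)) (at q within P_plus ix)"
  proof (rule has_derivative_caratheodory[where \<psi> = ?\<psi>, OF _ _ q])
    fix y assume y: "y \<in> P_plus ix"
    have expand: "fourier_char k \<theta> * (- trig_poly ix r \<theta> * z) =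
        (\<Sum>l\<in>UNIV. - r $ l * (fourier_char (k - ix l) \<theta> * z))" for r \<theta> z
      by (simp add: trig_poly_eq fourier_char_diff sum_distrib_left sum_distrib_right sum_negf mult_ac)
    have eq: "fourier_char k \<theta> * ?u y \<theta> ^ m - fourier_char k \<theta> * ?u q \<theta> ^ m =
        (\<Sum>l\<in>UNIV. - (y - q) $ l * (fourier_char (k - ix l) \<theta> * ?G y \<theta>))" for \<theta>
    proof -
      have "?u y \<theta> - ?u q \<theta> = - trig_poly ix (y - q) \<theta> * (?u y \<theta> * ?u q \<theta>)"
        using P_plus_nonzero[OF y, of \<theta>] P_plus_nonzero[OF q, of \<theta>]
        by (simp add: trig_poly_diff field_simps)
      then have "fourier_char k \<theta> * ?u y \<theta> ^ m - fourier_char k \<theta> * ?u q \<theta> ^ m =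
          fourier_char k \<theta> * (- trig_poly ix (y - q) \<theta> * ?G y \<theta>)"
        by (simp only: right_diff_distrib[symmetric] power_diff_sumr2 mult.assoc)
      also have "\<dots> = (\<Sum>l\<in>UNIV. - (y - q) $ l * (fourier_char (k - ix l) \<theta> * ?G y \<theta>))"
        by (rule expand)
      finally show ?thesis .
    qed
    have "torus_integral (\<lambda>\<theta>. fourier_char k \<theta> * ?u y \<theta> ^ m) -
        torus_integral (\<lambda>\<theta>. fourier_char k \<theta> * ?u q \<theta> ^ m) =
        torus_integral (\<lambda>\<theta>. \<Sum>l\<in>UNIV. - (y - q) $ l * (fourier_char (k - ix l) \<theta> * ?G y \<theta>))"
      unfolding eq[symmetric] by (rule torus_integral_diff[symmetric]) (intro cont y q)+
    also have "\<dots> = (\<Sum>l\<in>UNIV. torus_integral (\<lambda>\<theta>. - (y - q) $ l * (fourier_char (k - ix l) \<theta> * ?G y \<theta>)))"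
      by (intro torus_integral_sum continuous_on_mult continuous_on_const cont y)
    also have "\<dots> = (\<Sum>l\<in>UNIV. (y - q) $ l * ?\<psi> l y)"
      by (intro sum.cong refl, subst torus_integral_mult[OF cont(2)[OF y]]) (simp add: left_diff_distrib)
    finally show "torus_integral (\<lambda>\<theta>. fourier_char k \<theta> * ?u y \<theta> ^ m) -
        torus_integral (\<lambda>\<theta>. fourier_char k \<theta> * ?u q \<theta> ^ m) = (\<Sum>l\<in>UNIV. (y - q) $ l * ?\<psi> l y)" .
  next
    show "continuous_on (P_plus ix) (?\<psi> l)" for l
      using q unfolding case_prod_unfold
      by (intro continuous_on_minus continuous_on_torus_integral)
        (auto simp: case_prod_unfold P_plus_nonzero intro!: continuous_intros)
  qed
  moreover have "?\<psi> l q = - of_nat m *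
      torus_integral (\<lambda>\<theta>. fourier_char (k - ix l) \<theta> * ?u q \<theta> ^ Suc m)" for l
  proof -
    \<comment> \<open>On the diagonal the \<open>m\<close> summands coincide, which gives the
      coefficient of the power rule.\<close>
    have "?G q \<theta> = of_nat m * ?u q \<theta> ^ Suc m" for \<theta>
    proof (cases m)
      case (Suc n)
      have "(\<Sum>i<m. ?u q \<theta> ^ (m - Suc i) * ?u q \<theta> ^ i) = (\<Sum>i<m. ?u q \<theta> ^ n)"
        by (intro sum.cong refl) (simp add: Suc flip: power_add)
      then show ?thesis
        by (simp add: Suc)
    qed simp
    then have "?\<psi> l q = - torus_integral (\<lambda>\<theta>. of_nat m * (fourier_char (k - ix l) \<theta> * ?u q \<theta> ^ Suc m))"
      by (simp only: mult.left_commute)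
    also have "\<dots> = - of_nat m * torus_integral (\<lambda>\<theta>. fourier_char (k - ix l) \<theta> * ?u q \<theta> ^ Suc m)"
      by (subst torus_integral_mult) (intro continuous_intros q, simp)
    finally show ?thesis .
  qed
  ultimately show ?thesis
    by simp
qed

text \<open>Induction over the class. The assumptions cover the generators \<open>p\<close> and
  \<open>q\<close>, the chain rule covers the moments, and sums, products and reciprocals stay in
  the class.\<close>

lemma moment_fun_has_derivative:
  fixes ix :: "'l::finite \<Rightarrow> int ^ 'd::finite"
  assumes q: "\<And>x. x \<in> U \<Longrightarrow> q x \<in> P_plus ix"
    and dp: "\<And>x. x \<in> U \<Longrightarrow> (p has_derivative p' x) (at x within U)"
    and dq: "\<And>x. x \<in> U \<Longrightarrow> (q has_derivative q' x) (at x within U)"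
    and p': "\<And>v l. moment_fun ix U p q (\<lambda>x. p' x v $ l)"
    and q': "\<And>v l. moment_fun ix U p q (\<lambda>x. q' x v $ l)"
    and "moment_fun ix U p q f"
  shows "\<exists>f'. (\<forall>x\<in>U. (f has_derivative f' x) (at x within U)) \<and> (\<forall>v. moment_fun ix U p q (\<lambda>x. f' x v))"
  using assms(6)
proof induction
  case (const a)
  show ?case
    by (rule exI[of _ "\<lambda>_ _. 0"]) (auto intro: moment_fun.const)
next
  case (coeff_p l)
  show ?case
    using bounded_linear.has_derivative[OF bounded_linear_vec_nth dp] p'
    by (intro exI[of _ "\<lambda>x v. p' x v $ l"]) auto
next
  case (coeff_q l)
  show ?case
    using bounded_linear.has_derivative[OF bounded_linear_vec_nth dq] q'
    by (intro exI[of _ "\<lambda>x v. q' x v $ l"]) auto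
next
  case (moment k m)
  let ?D = "\<lambda>x v. \<Sum>l\<in>UNIV. q' x v $ l * (- of_nat m *
      torus_integral (\<lambda>\<theta>. fourier_char (k - ix l) \<theta> * inverse (trig_poly ix (q x) \<theta>) ^ Suc m))"
  have "((\<lambda>x. torus_integral (\<lambda>\<theta>. fourier_char k \<theta> * inverse (trig_poly ix (q x) \<theta>) ^ m))
      has_derivative ?D x) (at x within U)" if "x \<in> U" for x
    by (rule has_derivative_in_compose[OF dq[OF that]
          has_derivative_subset[OF has_derivative_moment[OF q[OF that]]]]) (use q in blast)
  moreover have "moment_fun ix U p q (\<lambda>x. ?D x v)" for v
    by (intro moment_fun_sum moment_fun.mult q' moment_fun.const moment_fun.moment)
  ultimately show ?case
    by (intro exI[of _ ?D]) blast
next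
  case (add f g)
  then obtain f' g' where
    "\<And>x. x \<in> U \<Longrightarrow> (f has_derivative f' x) (at x within U)" "\<And>v. moment_fun ix U p q (\<lambda>x. f' x v)"
    "\<And>x. x \<in> U \<Longrightarrow> (g has_derivative g' x) (at x within U)" "\<And>v. moment_fun ix U p q (\<lambda>x. g' x v)"
    by blast
  then show ?case
    by (intro exI[of _ "\<lambda>x v. f' x v + g' x v"]) (auto intro: has_derivative_add moment_fun.add)
next
  case (mult f g)
  then obtain f' g' where
    "\<And>x. x \<in> U \<Longrightarrow> (f has_derivative f' x) (at x within U)" "\<And>v. moment_fun ix U p q (\<lambda>x. f' x v)"
    "\<And>x. x \<in> U \<Longrightarrow> (g has_derivative g' x) (at x within U)" "\<And>v. moment_fun ix U p q (\<lambda>x. g' x v)"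
    by blast
  then show ?case
    using mult.hyps
    by (intro exI[of _ "\<lambda>x v. f x * g' x v + f' x v * g x"])
      (auto intro!: has_derivative_mult moment_fun.add moment_fun.mult)
next
  case (inverse f)
  then obtain f' where f':
    "\<And>x. x \<in> U \<Longrightarrow> (f has_derivative f' x) (at x within U)" "\<And>v. moment_fun ix U p q (\<lambda>x. f' x v)"
    by blast
  \<comment> \<open>The sign is written as multiplication by a constant, to match the constructors
    of the class.\<close>
  have "((\<lambda>x. inverse (f x)) has_derivative (\<lambda>v. - 1 * (inverse (f x) * f' x v * inverse (f x)))) (at x within U)"
    if "x \<in> U" for x
    using has_derivative_in_compose[OF f'(1)[OF that] has_derivative_inverse'[OF inverse.hyps(2)[OF that]]]
    by simp
  moreover have "moment_fun ix U p q (\<lambda>x. - 1 * (inverse (f x) * f' x v * inverse (f x)))" for v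
    by (intro moment_fun.mult moment_fun.const moment_fun.inverse inverse.hyps f')
  ultimately show ?case
    by (intro exI[of _ "\<lambda>x v. - 1 * (inverse (f x) * f' x v * inverse (f x))"]) blast
qed

lemma moment_fun_smooth_on:
  fixes ix :: "'l::finite \<Rightarrow> int ^ 'd::finite" and p q :: "complex ^ 'l \<Rightarrow> complex ^ 'l"
  assumes "\<And>x. x \<in> U \<Longrightarrow> q x \<in> P_plus ix"
    and "\<And>x. x \<in> U \<Longrightarrow> (p has_derivative p' x) (at x within U)"
    and "\<And>x. x \<in> U \<Longrightarrow> (q has_derivative q' x) (at x within U)"
    and "\<And>v l. moment_fun ix U p q (\<lambda>x. p' x v $ l)"
    and "\<And>v l. moment_fun ix U p q (\<lambda>x. q' x v $ l)"
  shows "smooth_on V U p" "smooth_on V U q"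
proof -
  have "Ck_on n V U f" if "moment_fun ix U p q f" for n f
  proof (rule Ck_on_closed_class[of "Collect (moment_fun ix U p q)"])
    fix h assume "h \<in> Collect (moment_fun ix U p q)"
    then have "\<exists>h'. (\<forall>x\<in>U. (h has_derivative h' x) (at x within U)) \<and> (\<forall>v. moment_fun ix U p q (\<lambda>x. h' x v))"
      by (intro moment_fun_has_derivative[OF assms]) auto
    then show "\<exists>h'. (\<forall>x\<in>U. (h has_derivative h' x) (at x within U)) \<and>
        (\<forall>v\<in>V. (\<lambda>x. h' x v) \<in> Collect (moment_fun ix U p q))"
      by (metis mem_Collect_eq)
  qed (use that in simp)
  then show "smooth_on V U p" "smooth_on V U q"
    unfolding smooth_on_def
    by (auto intro: Ck_on_vec moment_fun.coeff_p moment_fun.coeff_q)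
qed

context symmetric_index
begin

lemma moment_fun_resolvent_weight: "moment_fun ix U p q (\<lambda>x. resolvent_weight (q x) $ i $ j)"
  using moment_fun.moment[of ix U p q "ix i - ix j" 1]
  by (simp add: resolvent_weight_def weight_matrix_def)

text \<open>
  On the diagonal \<open>increment_weight\<close> agrees with this combination of moments, which is in
  \<^const>\<open>moment_fun\<close> without any assumption on the points outside \<open>U\<close>.
\<close>

definition diagonal_weight :: "complex ^ 'l \<Rightarrow> complex ^ 'l \<Rightarrow> complex ^ 'l ^ 'l" where
  "diagonal_weight p q = (\<chi> i j. \<Sum>l\<in>UNIV. p $ l *
     torus_integral (\<lambda>\<theta>. fourier_char (ix i - ix j - ix l) \<theta> * inverse (trig_poly ix q \<theta>) ^ 2))"

lemma moment_fun_diagonal_weight: "moment_fun ix U p q (\<lambda>x. diagonal_weight (p x) (q x) $ i $ j)"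
  unfolding diagonal_weight_def vec_lambda_beta
  by (intro moment_fun_sum moment_fun.mult moment_fun.coeff_p moment_fun.moment)

lemma increment_weight_diagonal:
  assumes q: "q \<in> P_plus ix"
  shows "increment_weight p q q = diagonal_weight p q"
proof -
  let ?u = "\<lambda>\<theta>. inverse (trig_poly ix q \<theta>)"
  have "torus_integral (\<lambda>\<theta>. fourier_char k \<theta> * (trig_poly ix p \<theta> * ?u \<theta> * ?u \<theta>)) =
      (\<Sum>l\<in>UNIV. p $ l * torus_integral (\<lambda>\<theta>. fourier_char (k - ix l) \<theta> * ?u \<theta> ^ 2))" for k
  proof -
    have "(\<lambda>\<theta>. fourier_char k \<theta> * (trig_poly ix p \<theta> * ?u \<theta> * ?u \<theta>)) =
        (\<lambda>\<theta>. \<Sum>l\<in>UNIV. p $ l * (fourier_char (k - ix l) \<theta> * ?u \<theta> ^ 2))"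
      by (simp add: fun_eq_iff trig_poly_eq fourier_char_diff power2_eq_square sum_distrib_left
          sum_distrib_right mult_ac)
    then have "torus_integral (\<lambda>\<theta>. fourier_char k \<theta> * (trig_poly ix p \<theta> * ?u \<theta> * ?u \<theta>)) =
        torus_integral (\<lambda>\<theta>. \<Sum>l\<in>UNIV. p $ l * (fourier_char (k - ix l) \<theta> * ?u \<theta> ^ 2))"
      by simp
    also have "\<dots> = (\<Sum>l\<in>UNIV. torus_integral (\<lambda>\<theta>. p $ l * (fourier_char (k - ix l) \<theta> * ?u \<theta> ^ 2)))"
      by (rule torus_integral_sum) (intro continuous_intros q)
    also have "\<dots> = (\<Sum>l\<in>UNIV. p $ l * torus_integral (\<lambda>\<theta>. fourier_char (k - ix l) \<theta> * ?u \<theta> ^ 2))"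
      by (intro sum.cong refl torus_integral_mult continuous_intros q)
    finally show ?thesis .
  qed
  then show ?thesis
    by (simp add: increment_weight_def weight_matrix_def diagonal_weight_def)
qed

lemma continuous_on_increment_weight:
  assumes "q \<in> P_plus ix"
  shows "continuous_on (P_plus ix) (increment_weight p q)"
  unfolding increment_weight_def using assms
  by (intro continuous_on_weight_matrix)
    (auto simp: case_prod_unfold P_plus_nonzero intro!: continuous_intros)

text \<open>The increment identity solved for the increment of \<open>p\<close>. Its coefficient
  matrix contains \<open>p\<close> only at the base point, so continuity of \<open>p\<close> comes
  out as a consequence.\<close>

lemma smooth_on_first_argument:
  assumes U: "U \<subseteq> P_plus ix" and p: "\<And>q. q \<in> U \<Longrightarrow> p q \<in> P_plus ix"
    and c: "\<And>q. q \<in> U \<Longrightarrow> moment_map ix (p q) q = c"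
  shows "smooth_on V U p"
proof -
  let ?p' = "\<lambda>x v. (cramer_inverse (resolvent_weight x) ** diagonal_weight (p x) x) *v v"
  have "(p has_derivative ?p' x) (at x within U)" if x: "x \<in> U" for x
  proof -
    have xP: "x \<in> P_plus ix"
      using x U by blast
    let ?M = "\<lambda>y. cramer_inverse (resolvent_weight y) ** increment_weight (p x) x y"
    have "(p has_derivative (\<lambda>v. ?M x *v v)) (at x within U)"
    proof (rule has_derivative_caratheodory_matrix[where M = ?M, OF _ _ x])
      fix y assume y: "y \<in> U"
      then have yP: "y \<in> P_plus ix"
        using U by blast
      have "resolvent_weight y *v (p y - p x) = increment_weight (p x) x y *v (y - x)"
        unfolding resolvent_weight_def increment_weight_def
        using c[OF x] c[OF y] by (intro moment_map_increment xP yP) simp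
      from cramer_inverse_solve[OF det_resolvent_weight[OF yP] this]
      show "p y - p x = ?M y *v (y - x)"
        by (simp only: matrix_vector_mul_assoc)
    next
      show "continuous_on U ?M"
        using xP by (intro continuous_on_subset[OF _ U] continuous_on_matrix_mult continuous_on_cramer_inverse
            continuous_on_resolvent_weight continuous_on_increment_weight det_resolvent_weight)
    qed
    then show ?thesis
      by (simp add: increment_weight_diagonal[OF xP])
  qed
  moreover have "moment_fun ix U p (\<lambda>x. x) (\<lambda>x. ?p' x v $ l)" for v l
    using U by (intro moment_fun_matrix_vector_mult moment_fun_matrix_mult moment_fun_cramer_inverse
        moment_fun_resolvent_weight[where q = "\<lambda>x. x"] moment_fun_diagonal_weight[where q = "\<lambda>x. x"]
        det_resolvent_weight) blast
  moreover have "((\<lambda>x. x) has_derivative (\<lambda>v. v)) (at x within U)" for x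
    by (rule has_derivative_ident)
  ultimately show ?thesis
    using U by (intro moment_fun_smooth_on(1)[of U "\<lambda>x. x" ix p ?p' "\<lambda>x v. v"] moment_fun.const) auto
qed

text \<open>The same identity solved for the increment of \<open>q\<close>. The coefficient matrix
  now contains \<open>q y\<close>, so continuity of \<open>q\<close> is an input; for
  \<open>g_map\<close> it comes from properness.\<close>

lemma smooth_on_second_argument:
  assumes U: "U \<subseteq> P_plus ix" and q: "\<And>p. p \<in> U \<Longrightarrow> q p \<in> P_plus ix" and cont: "continuous_on U q"
    and c: "\<And>p. p \<in> U \<Longrightarrow> moment_map ix p (q p) = c"
  shows "smooth_on V U q"
proof -
  let ?q' = "\<lambda>x v. (cramer_inverse (diagonal_weight x (q x)) ** resolvent_weight (q x)) *v v"
  have "(q has_derivative ?q' x) (at x within U)" if x: "x \<in> U" for x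
  proof -
    let ?M = "\<lambda>y. cramer_inverse (increment_weight x (q x) (q y)) ** resolvent_weight (q y)"
    have "(q has_derivative (\<lambda>v. ?M x *v v)) (at x within U)"
    proof (rule has_derivative_caratheodory_matrix[where M = ?M, OF _ _ x])
      fix y assume y: "y \<in> U"
      have "increment_weight x (q x) (q y) *v (q y - q x) = resolvent_weight (q y) *v (y - x)"
        unfolding resolvent_weight_def increment_weight_def
        using c[OF x] c[OF y] by (intro moment_map_increment[symmetric] q x y) simp
      from cramer_inverse_solve[OF det_increment_weight[OF subsetD[OF U x] q[OF x] q[OF y]] this]
      show "q y - q x = ?M y *v (y - x)"
        by (simp only: matrix_vector_mul_assoc)
    next
      show "continuous_on U ?M"
        using x U q
        by (intro continuous_on_matrix_mult continuous_on_cramer_inverse det_increment_weight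
            continuous_on_compose2[OF continuous_on_resolvent_weight cont]
            continuous_on_compose2[OF continuous_on_increment_weight cont]) auto
    qed
    then show ?thesis
      by (simp add: increment_weight_diagonal[OF q[OF x]])
  qed
  moreover have "moment_fun ix U (\<lambda>x. x) q (\<lambda>x. ?q' x v $ l)" for v l
  proof -
    have "det (diagonal_weight x (q x)) \<noteq> 0" if "x \<in> U" for x
      using det_increment_weight[of x "q x" "q x"] that U q by (auto simp: increment_weight_diagonal)
    then show ?thesis
      by (intro moment_fun_matrix_vector_mult moment_fun_matrix_mult moment_fun_cramer_inverse
        moment_fun_resolvent_weight moment_fun_diagonal_weight[where p = "\<lambda>x. x"])
  qed
  moreover have "((\<lambda>x. x) has_derivative (\<lambda>v. v)) (at x within U)" for x
    by (rule has_derivative_ident)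
  ultimately show ?thesis
    using q by (intro moment_fun_smooth_on(2)[of U q ix "\<lambda>x. x" "\<lambda>x v. v" ?q'] moment_fun.const) auto
qed

lemma diffeomorphism_on_g_map:
  assumes d: "CARD('d) \<le> 2" and c: "c \<in> C_plus ix"
  shows "diffeomorphism_on (herm_space ix) (P_plus ix) (Q_plus ix c) (g_map ix c)"
  unfolding diffeomorphism_on_def
proof (intro conjI openin_P_plus openin_Q_plus d c)
  let ?h = "the_inv_into (P_plus ix) (g_map ix c)"
  note inj = inj_on_g_map[OF d c]
  show "bij_betw (g_map ix c) (P_plus ix) (Q_plus ix c)"
    using inj by (simp add: bij_betw_def Q_plus_def)
  show "smooth_on (herm_space ix) (P_plus ix) (g_map ix c)"
    using continuous_on_g_map[OF d c] g_map_in_P_plus[OF d c] moment_map_g_map[OF d c]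
    by (intro smooth_on_second_argument) auto
  show "smooth_on (herm_space ix) (Q_plus ix c) ?h"
  \<comment> \<open>The inverse assigns to \<open>q\<close> the \<open>p\<close> with moments
    \<open>c\<close>: the same solution set, parametrised by its second argument.\<close>
  proof (rule smooth_on_first_argument)
    show "Q_plus ix c \<subseteq> P_plus ix"
      using g_map_in_P_plus[OF d c] by (auto simp: Q_plus_def)
    fix q assume q: "q \<in> Q_plus ix c"
    show h: "?h q \<in> P_plus ix"
      using q by (intro the_inv_into_into[OF inj]) (auto simp: Q_plus_def)
    have "g_map ix c (?h q) = q"
      using q by (intro f_the_inv_into_f[OF inj]) (simp add: Q_plus_def)
    then show "moment_map ix (?h q) q = c"
      using moment_map_g_map[OF d c h] by simp
  qed
qed

end

theorem theorem4p5:
  fixes \<Lambda> :: "(int ^ 'd::finite) set"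
    and ix :: "'l::finite \<Rightarrow> int ^ 'd"
    and c :: "complex ^ 'l"
  assumes "CARD('d) \<le> 2"
    and "bij_betw ix UNIV \<Lambda>"
    and "0 \<in> \<Lambda>"
    and "uminus ` \<Lambda> = \<Lambda>"
    and "c \<in> C_plus ix"
  shows "(\<forall>p \<in> P_plus ix. bij_betw (moment_map ix p) (P_plus ix) (C_plus ix)) \<and>
         g_map ix c ` P_plus ix \<subseteq> P_plus ix \<and>
         diffeomorphism_on (herm_space ix) (P_plus ix) (Q_plus ix c) (g_map ix c)"
proof -
  have "inj ix" and range: "range ix = \<Lambda>"
    using assms(2) by (auto simp: bij_betw_def)
  moreover have "\<exists>m. ix m = - ix l" for l
  proof -
    have "- ix l \<in> uminus ` \<Lambda>"
      using range by blast
    then have "- ix l \<in> range ix"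
      by (simp only: assms(4) range)
    then obtain m where "- ix l = ix m" ..
    then show ?thesis
      by (intro exI[of _ m]) simp
  qed
  moreover have "\<exists>l. ix l = 0"
    using assms(3) unfolding range[symmetric] by (auto intro: sym)
  ultimately interpret symmetric_index ix
    by unfold_locales
  show ?thesis
  proof (intro conjI ballI image_subsetI)
    show "bij_betw (moment_map ix p) (P_plus ix) (C_plus ix)" if "p \<in> P_plus ix" for p
      using assms(1) that by (rule bij_betw_moment_map)
    show "g_map ix c p \<in> P_plus ix" if "p \<in> P_plus ix" for p
      using assms(1,5) that by (rule g_map_in_P_plus)
    show "diffeomorphism_on (herm_space ix) (P_plus ix) (Q_plus ix c) (g_map ix c)"
      using assms(1,5) by (rule diffeomorphism_on_g_map)
  qed
qed

end
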